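(* Consider the problem of minimizing $J(x(\cdot))=\int_{t_0}^{t_1}L(t,x(t),\dot x(t))\,dt$ over $x(\cdot)\in KC^1(I,\mathbb R^n)$ with $x(t_0)=x_0$, $x(t_1)=x_1$. Let the functions $L$ and $L_{\dot x}$ be continuously differentiable in the totality of their variables, and let the admissible function $\bar x(\cdot)$ be a weak local minimum in this problem. Then there exists $\delta>0$ for which the following statements are valid: (j) If at the point $\theta\in[t_0,t_1)$ (respectively $\theta\in(t_0,t_1]$) the function $\bar x(\cdot)$ is twice differentiable on the right (left) in a semi-neighborhood $[\theta,\theta+\alpha)\subset I$ (respectively $(\theta-\alpha,\theta]\subset I$), $\alpha>0$, of $\theta$, then for every point $\big(\eta,(\bar\lambda-1)^{-1}\bar\lambda\eta,\bar\lambda\big)\in B_\delta(0)\times B_\delta(0)\times(0,1)$ satisfying $$E(\bar L)(\theta+,\eta)=E(\bar L)\big(\theta+,(\bar\lambda-1)^{-1}\bar\lambda\eta\big)=0$$ $$\Big(\text{respectively } E(\bar L)(\theta-,\eta)=E(\bar L)\big(\theta-,(\bar\lambda-1)^{-1}\bar\lambda\eta\big)=0\Big)$$ one has $$\bar\lambda M_1(\bar L_x)(\theta+,\bar\lambda,\eta)+\frac{d}{dt}Q_2(\bar L)(\theta+,\bar\lambda,\eta)\ge0$$ $$\Big(\text{respectively } \bar\lambda M_1(\bar L_x)(\theta-,\bar\lambda,\eta)+\frac{d}{dt}Q_2(\bar L)(\theta-,\bar\lambda,\eta)\le0\Big).$$ (jj) If at the point $\theta\in(t_0,t_1)$ the function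 $\bar x(\cdot)$ is twice differentiable, then for every point $\big(\eta,(\bar\lambda-1)^{-1}\bar\lambda\eta,\bar\lambda\big)\in B_\delta(0)\times B_\delta(0)\times(0,1)$ satisfying $$E(\bar L)(\theta,\eta)=E(\bar L)\big(\theta,(\bar\lambda-1)^{-1}\bar\lambda\eta\big)=0$$ one has $$\bar\lambda\,\Delta\bar L_x^T(\theta,\eta)\eta+(1-\bar\lambda)\,\Delta\bar L_x^T\big(\theta,(\bar\lambda-1)^{-1}\bar\lambda\eta\big)\eta=0.$$
   Context: Setting. $(a,b)\subset\mathbb R$ is an interval, $I:=[t_0,t_1]\subset(a,b)$ with $t_0<t_1$, $x_0,x_1\in\mathbb R^n$, and $L=L(t,x,\dot x):(a,b)\times\mathbb R^n\times\mathbb R^n\to\mathbb R$ is continuously differentiable in the totality of variables; $L_x,L_{\dot x}$ are its partial gradients (column vectors) with respect to the second and third arguments; $T$ denotes transposition; $B_\delta(0)$ is the closed ball of radius $\delta$ centered at $0\in\mathbb R^n$. $KC^1(I,\mathbb R^n)$ is the set of piecewise-smooth functions: continuous functions $x:I\to\mathbb R^n$ whose derivative is continuous on $I$ except at finitely many points of $(t_0,t_1)$ (angular points), where $\dot x$ has discontinuities of the first kind (finite one-sided limits); at $t_0$ and $t_1$ the right, respectively left, values of $\dot x$ are finite. A function $x(\cdot)\in KC^1(I,\mathbb R^n)$ with $x(t_0)=x_0$, $x(t_1)=x_1$ is called admissible. An admissible $\bar x(\cdot)$ is a weak local minimum if there is $\hat\delta>0$ such that $J(x(\cdot))\ge J(\bar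 x(\cdot))$ for all admissible $x(\cdot)$ with $\max\{\|x(\cdot)-\bar x(\cdot)\|_{C(I,\mathbb R^n)},\|\dot x(\cdot)-\dot{\bar x}(\cdot)\|_{L_\infty(I,\mathbb R^n)}\}\le\hat\delta$. Notation along $\bar x(\cdot)$, for $\xi\in\mathbb R^n$: $\bar L(t)=L(t,\bar x(t),\dot{\bar x}(t))$, $\bar L_x(t)=L_x(t,\bar x(t),\dot{\bar x}(t))$, $\bar L_{\dot x}(t)=L_{\dot x}(t,\bar x(t),\dot{\bar x}(t))$, $$E(\bar L)(t,\xi)=L(t,\bar x(t),\dot{\bar x}(t)+\xi)-\bar L(t)-\bar L_{\dot x}^T(t)\xi,\qquad \Delta\bar L_x(t,\xi)=L_x(t,\bar x(t),\dot{\bar x}(t)+\xi)-\bar L_x(t),$$ and, for $\lambda\in[0,1)$, $$Q_2(\bar L)(t,\lambda,\xi)=\lambda^2E(\bar L)(t,\xi)+(1-\lambda^2)E(\bar L)\Big(t,\tfrac{\lambda}{\lambda-1}\xi\Big),$$ $$M_1(\bar L_x)(t,\lambda,\xi)=\lambda\,\Delta\bar L_x^T(t,\xi)\xi+(1-\lambda)\,\Delta\bar L_x^T\Big(t,\tfrac{\lambda}{\lambda-1}\xi\Big)\xi.$$ One-sided values: $F(\theta+)$ (resp. $F(\theta-)$) is the right-hand (left-hand) limit of $F$ at $\theta$; for the functions above it is obtained by using $\dot{\bar x}(\theta+)$ (resp. $\dot{\bar x}(\theta-)$) in place of $\dot{\bar x}(\theta)$. $\frac{d}{dt}F(\theta\pm,\cdot)$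 is the corresponding one-sided derivative at $\theta$ of $t\mapsto F(t,\cdot)$ (other arguments fixed), where the value at $\theta$ is taken to be $F(\theta\pm,\cdot)$. *)

theory Defs
  imports "HOL-Analysis.Analysis" "HOL-Probability.Essential_Supremum"
begin

text \<open>Only used on open sets \<open>S\<close>; the derivative is the total (Frechet) one, and its
  continuity is with respect to the operator norm.\<close>

definition C1_on :: "'a::real_normed_vector set \<Rightarrow> ('a \<Rightarrow> 'b::real_normed_vector) \<Rightarrow> bool" where
  "C1_on S f \<longleftrightarrow>
     (\<exists>f' :: 'a \<Rightarrow> 'a \<Rightarrow>\<^sub>L 'b.
        (\<forall>z\<in>S. (f has_derivative blinfun_apply (f' z)) (at z)) \<and> continuous_on S f')"

definition grad :: "('a::real_inner \<Rightarrow> real) \<Rightarrow> 'a \<Rightarrow> 'a" where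
  "grad f x = (THE D. GDERIV f x :> D)"

type_synonym 'n lagrangian = "real \<Rightarrow> real ^ 'n \<Rightarrow> real ^ 'n \<Rightarrow> real"

definition L_x :: "'n::finite lagrangian \<Rightarrow> real \<Rightarrow> real ^ 'n \<Rightarrow> real ^ 'n \<Rightarrow> real ^ 'n" where
  "L_x L t x v = grad (\<lambda>y. L t y v) x"

definition L_v :: "'n::finite lagrangian \<Rightarrow> real \<Rightarrow> real ^ 'n \<Rightarrow> real ^ 'n \<Rightarrow> real ^ 'n" where
  "L_v L t x v = grad (\<lambda>w. L t x w) v"

text \<open>A function on the interval \<open>I\<close> is represented by a total function of which only the
  values on \<open>I\<close> matter. Accordingly \<open>vel I x t\<close> is the two-sided derivative at interior points
  and the one-sided one at end points of \<open>I\<close>. Where \<open>x\<close> is not differentiable it is an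
  arbitrary value.\<close>

definition vel :: "real set \<Rightarrow> (real \<Rightarrow> 'a::real_normed_vector) \<Rightarrow> real \<Rightarrow> 'a" where
  "vel I x t = vector_derivative x (at t within I)"

definition KC1 :: "real \<Rightarrow> real \<Rightarrow> (real \<Rightarrow> 'a::real_normed_vector) set" where
  "KC1 t0 t1 = {x. continuous_on {t0..t1} x \<and>
     (\<exists>S. finite S \<and> S \<subseteq> {t0<..<t1} \<and>
        (\<forall>t\<in>{t0..t1} - S. x differentiable (at t within {t0..t1})) \<and>
        continuous_on ({t0..t1} - S) (vel {t0..t1} x) \<and>
        (\<forall>s\<in>S. (\<exists>l. (vel {t0..t1} x \<longlongrightarrow> l) (at_left s)) \<and>
                (\<exists>l. (vel {t0..t1} x \<longlongrightarrow> l) (at_right s))))}"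

definition admissible ::
  "real \<Rightarrow> real \<Rightarrow> 'a::real_normed_vector \<Rightarrow> 'a \<Rightarrow> (real \<Rightarrow> 'a) \<Rightarrow> bool" where
  "admissible t0 t1 x0 x1 x \<longleftrightarrow> x \<in> KC1 t0 t1 \<and> x t0 = x0 \<and> x t1 = x1"

definition J :: "'n::finite lagrangian \<Rightarrow> real \<Rightarrow> real \<Rightarrow> (real \<Rightarrow> real ^ 'n) \<Rightarrow> real" where
  "J L t0 t1 x = integral {t0..t1} (\<lambda>t. L t (x t) (vel {t0..t1} x t))"

definition C_norm :: "real set \<Rightarrow> (real \<Rightarrow> 'a::real_normed_vector) \<Rightarrow> ereal" where
  "C_norm I f = (SUP t\<in>I. ereal (norm (f t)))"

definition Linf_norm :: "real set \<Rightarrow> (real \<Rightarrow> 'a::real_normed_vector) \<Rightarrow> ereal" where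
  "Linf_norm I f = esssup (lebesgue_on I) (\<lambda>t. ereal (norm (f t)))"

definition weak_local_min ::
  "'n::finite lagrangian \<Rightarrow> real \<Rightarrow> real \<Rightarrow> real ^ 'n \<Rightarrow> real ^ 'n \<Rightarrow> (real \<Rightarrow> real ^ 'n) \<Rightarrow> bool" where
  "weak_local_min L t0 t1 x0 x1 xb \<longleftrightarrow>
     admissible t0 t1 x0 x1 xb \<and>
     (\<exists>\<delta>>0. \<forall>x. admissible t0 t1 x0 x1 x \<and>
        max (C_norm {t0..t1} (\<lambda>t. x t - xb t))
            (Linf_norm {t0..t1} (\<lambda>t. vel {t0..t1} x t - vel {t0..t1} xb t)) \<le> ereal \<delta>
        \<longrightarrow> J L t0 t1 x \<ge> J L t0 t1 xb)"

definition Ebar ::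
  "'n::finite lagrangian \<Rightarrow> real set \<Rightarrow> (real \<Rightarrow> real ^ 'n) \<Rightarrow> real \<Rightarrow> real ^ 'n \<Rightarrow> real" where
  "Ebar L I xb t \<xi> =
     L t (xb t) (vel I xb t + \<xi>) - L t (xb t) (vel I xb t) - L_v L t (xb t) (vel I xb t) \<bullet> \<xi>"

definition DLx ::
  "'n::finite lagrangian \<Rightarrow> real set \<Rightarrow> (real \<Rightarrow> real ^ 'n) \<Rightarrow> real \<Rightarrow> real ^ 'n \<Rightarrow> real ^ 'n" where
  "DLx L I xb t \<xi> = L_x L t (xb t) (vel I xb t + \<xi>) - L_x L t (xb t) (vel I xb t)"

definition Q2 ::
  "'n::finite lagrangian \<Rightarrow> real set \<Rightarrow> (real \<Rightarrow> real ^ 'n) \<Rightarrow> real \<Rightarrow> real \<Rightarrow> real ^ 'n \<Rightarrow> real" where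
  "Q2 L I xb t lam \<xi> =
     lam\<^sup>2 * Ebar L I xb t \<xi> + (1 - lam\<^sup>2) * Ebar L I xb t ((lam / (lam - 1)) *\<^sub>R \<xi>)"

definition M1 ::
  "'n::finite lagrangian \<Rightarrow> real set \<Rightarrow> (real \<Rightarrow> real ^ 'n) \<Rightarrow> real \<Rightarrow> real \<Rightarrow> real ^ 'n \<Rightarrow> real" where
  "M1 L I xb t lam \<xi> =
     lam * (DLx L I xb t \<xi> \<bullet> \<xi>) + (1 - lam) * (DLx L I xb t ((lam / (lam - 1)) *\<^sub>R \<xi>) \<bullet> \<xi>)"

text \<open>One-sided values \<open>F(\<theta>+)\<close>, \<open>F(\<theta>-)\<close>, and the one-sided derivatives of \<open>F\<close> at \<open>\<theta>\<close>
  after the value of \<open>F\<close> at \<open>\<theta>\<close> has been replaced by \<open>F(\<theta>+)\<close>, resp. \<open>F(\<theta>-)\<close>.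
  Along a \<open>KC1\<close> curve that is twice differentiable on the respective side these limits and
  derivatives exist for \<open>Ebar\<close>, \<open>Q2\<close>, \<open>M1\<close> (the latter: limits only) when \<open>L\<close>, \<open>L_v\<close> are C1.\<close>

definition rval :: "(real \<Rightarrow> real) \<Rightarrow> real \<Rightarrow> real" where
  "rval F \<theta> = Lim (at_right \<theta>) F"

definition lval :: "(real \<Rightarrow> real) \<Rightarrow> real \<Rightarrow> real" where
  "lval F \<theta> = Lim (at_left \<theta>) F"

definition rderiv :: "(real \<Rightarrow> real) \<Rightarrow> real \<Rightarrow> real" where
  "rderiv F \<theta> = vector_derivative (F(\<theta> := rval F \<theta>)) (at_right \<theta>)"

definition lderiv :: "(real \<Rightarrow> real) \<Rightarrow> real \<Rightarrow> real" where
  "lderiv F \<theta> = vector_derivative (F(\<theta> := lval F \<theta>)) (at_left \<theta>)"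

text \<open>Derivatives are taken within \<open>S\<close>, hence are one-sided at an end point of an interval
  \<open>S\<close> that belongs to \<open>S\<close>. In particular \<open>x\<close> may have an angular point there as a function
  on a larger interval.\<close>

definition twice_differentiable_on :: "real set \<Rightarrow> (real \<Rightarrow> 'a::real_normed_vector) \<Rightarrow> bool" where
  "twice_differentiable_on S x \<longleftrightarrow>
     (\<forall>t\<in>S. x differentiable (at t within S)) \<and>
     (\<forall>t\<in>S. vel S x differentiable (at t within S))"

definition twice_differentiable_at :: "real \<Rightarrow> (real \<Rightarrow> 'a::real_normed_vector) \<Rightarrow> bool" where
  "twice_differentiable_at \<theta> x \<longleftrightarrow>
     (\<forall>\<^sub>F t in nhds \<theta>. x differentiable (at t)) \<and>
     (\<lambda>t. vector_derivative x (at t)) differentiable (at \<theta>)"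

end

theory Submission
  imports Defs
begin

text \<open>Perturb the minimizer \<open>x\<close> by a hat function supported on \<open>[\<theta>, \<theta> + \<epsilon>]\<close> (or on
  \<open>[\<theta> - \<epsilon>, \<theta>]\<close>) with slopes \<open>\<eta>\<close> on a piece of length \<open>\<lambda>\<epsilon>\<close> and
  \<open>\<xi> = \<lambda>\<eta>/(\<lambda> - 1)\<close> on the rest. Since the first variation vanishes, the increment of the
  functional is the integral of the excess
  \<open>L(t, x + h, x' + h') - L(t, x, x') - L\<^sub>x h - L\<^sub>v h'\<close>. When \<open>E(\<theta>, \<eta>) = E(\<theta>, \<xi>) = 0\<close> it equals
  \<open>\<plusminus> \<epsilon>\<^sup>2/2 (\<lambda> M\<^sub>1 + dQ\<^sub>2/dt) + o(\<epsilon>\<^sup>2)\<close>, which gives the one-sided inequalities. At a point of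
  two-sided differentiability \<open>E(t, \<eta>) \<ge> 0\<close> by the Weierstrass condition, so \<open>E(\<cdot>, \<eta>)\<close> and
  \<open>E(\<cdot>, \<xi>)\<close> have a minimum at \<open>\<theta>\<close>, \<open>dQ\<^sub>2/dt\<close> vanishes, and both inequalities together
  give \<open>M\<^sub>1 = 0\<close>.\<close>

section \<open>Piecewise smooth functions\<close>

text \<open>Why the order is \<open>\<epsilon>^2\<close>: near \<theta> the excess on a leg depends
  on time and on the displacement \<open>r\<close>, vanishes at \<open>(\<theta>, 0)\<close>, hence
  is linear there up to \<open>o(\<epsilon>)\<close>, and the support has length \<epsilon>. In the
  scaled time \<tau> the weights \<open>\<lambda>^2\<close> and \<open>1 - \<lambda>^2\<close> of
  \<open>Q2\<close> are twice the integrals of \<tau> over \<open>[0, \<lambda>]\<close> and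
  \<open>[\<lambda>, 1]\<close>; \<open>M1\<close> collects the displacements, \<tau> on the first
  leg and \<open>\<tau> - 1\<close> on the second. The value of \<xi> is forced by
  \<open>\<lambda> \<eta> + (1 - \<lambda>) \<xi> = 0\<close>: the hat must return to zero. To the
  left of \<theta> the legs are interchanged, so that the one with slope \<eta> again ends at
  \<theta>; this reverses all signs. The obstacle is low regularity. \<open>L_x\<close> is only
  continuous and the second derivative of \<open>x\<close> may be discontinuous, so there is no
  Taylor expansion around \<theta>; what is available is Frechet differentiability of the excess in
  \<open>(t, r)\<close> at the single point \<open>(\<theta>, 0)\<close>. Moreover \<theta> may be
  an angular point, so the excess is formed with a one-sided velocity \<open>u\<close> instead of
  \<open>vel\<close>.\<close>

lemma at_within_Icc_neq_bot:
  fixes t :: real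
  assumes "t0 < t1" "t \<in> {t0..t1}"
  shows "at t within {t0..t1} \<noteq> bot"
  using assms by (simp add: trivial_limit_within islimpt_Icc)

lemma vel_eqI:
  assumes "t0 < t1" "t \<in> {t0..t1}" "(x has_vector_derivative v) (at t within {t0..t1})"
  shows "vel {t0..t1} x t = v"
  unfolding vel_def
  using vector_derivative_within[OF at_within_Icc_neq_bot[OF assms(1,2)] assms(3)] .

lemma vel_eqI_interior:
  assumes "t \<in> {t0<..<t1}" "(x has_vector_derivative v) (at t)"
  shows "vel {t0..t1} x t = v"
  by (rule vel_eqI[OF _ _ has_vector_derivative_at_within[OF assms(2)]]) (use assms(1) in auto)

lemma has_vector_derivative_vel:
  assumes "x differentiable (at t within I)"
  shows "(x has_vector_derivative vel I x t) (at t within I)"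
  using assms unfolding vel_def by (simp add: vector_derivative_works)

lemma vel_add:
  assumes "t0 < t1" "t \<in> {t0..t1}"
    "x differentiable (at t within {t0..t1})" "y differentiable (at t within {t0..t1})"
  shows "vel {t0..t1} (\<lambda>t. x t + y t) t = vel {t0..t1} x t + vel {t0..t1} y t"
  using assms by (intro vel_eqI has_vector_derivative_add has_vector_derivative_vel) auto

lemma KC1E:
  assumes "x \<in> KC1 t0 t1"
  obtains S where "finite S" "S \<subseteq> {t0<..<t1}" "continuous_on {t0..t1} x"
    "\<And>t. t \<in> {t0..t1} - S \<Longrightarrow> x differentiable (at t within {t0..t1})"
    "continuous_on ({t0..t1} - S) (vel {t0..t1} x)"
    "\<And>s. s \<in> S \<Longrightarrow> \<exists>l. (vel {t0..t1} x \<longlongrightarrow> l) (at_left s)"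
    "\<And>s. s \<in> S \<Longrightarrow> \<exists>l. (vel {t0..t1} x \<longlongrightarrow> l) (at_right s)"
  using assms unfolding KC1_def by blast

lemma KC1I:
  assumes "finite S" "S \<subseteq> {t0<..<t1}" "continuous_on {t0..t1} x"
    "\<And>t. t \<in> {t0..t1} - S \<Longrightarrow> x differentiable (at t within {t0..t1})"
    "continuous_on ({t0..t1} - S) (vel {t0..t1} x)"
    "\<And>s. s \<in> S \<Longrightarrow> \<exists>l. (vel {t0..t1} x \<longlongrightarrow> l) (at_left s)"
    "\<And>s. s \<in> S \<Longrightarrow> \<exists>l. (vel {t0..t1} x \<longlongrightarrow> l) (at_right s)"
  shows "x \<in> KC1 t0 t1"
  unfolding KC1_def
  by (intro CollectI conjI exI[of _ S] ballI) (fact assms | erule assms)+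

lemma isCont_off_finite:
  fixes t0 t1 :: real
  assumes "finite S" "continuous_on ({t0..t1} - S) f" "t \<in> {t0<..<t1} - S"
  shows "isCont f t"
proof -
  have "open ({t0<..<t1} - S)"
    using assms(1) by (intro open_Diff finite_imp_closed open_greaterThanLessThan)
  moreover have "continuous_on ({t0<..<t1} - S) f"
    using assms(2) by (rule continuous_on_subset) auto
  ultimately show ?thesis
    using assms(3) continuous_on_eq_continuous_at by blast
qed

text \<open>\<open>KC1\<close> provides one-sided limits at the exceptional points; at the other
  interior points they come from continuity. Having them everywhere lets the exceptional sets of two
  functions be merged.\<close>

lemma KC1_vel_one_sided_limits:
  assumes "x \<in> KC1 t0 t1" "s \<in> {t0<..<t1}"
  shows "\<exists>l. (vel {t0..t1} x \<longlongrightarrow> l) (at_left s)" "\<exists>l. (vel {t0..t1} x \<longlongrightarrow> l) (at_right s)"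
proof -
  obtain S where S: "finite S" "continuous_on ({t0..t1} - S) (vel {t0..t1} x)"
    "\<And>s. s \<in> S \<Longrightarrow> \<exists>l. (vel {t0..t1} x \<longlongrightarrow> l) (at_left s)"
    "\<And>s. s \<in> S \<Longrightarrow> \<exists>l. (vel {t0..t1} x \<longlongrightarrow> l) (at_right s)"
    using KC1E[OF assms(1)] by metis
  have lim: "(vel {t0..t1} x \<longlongrightarrow> vel {t0..t1} x s) (at s within T)" if "s \<notin> S" for T
  proof -
    have "isCont (vel {t0..t1} x) s"
      using assms(2) that by (intro isCont_off_finite[OF S(1,2)]) auto
    then show ?thesis
      unfolding isCont_def by (rule tendsto_within_subset) auto
  qed
  show "\<exists>l. (vel {t0..t1} x \<longlongrightarrow> l) (at_left s)"
    by (cases "s \<in> S") (auto dest: S(3) lim)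
  show "\<exists>l. (vel {t0..t1} x \<longlongrightarrow> l) (at_right s)"
    by (cases "s \<in> S") (auto dest: S(4) lim)
qed

lemma eventually_at_within_notin_finite:
  fixes s :: "'a::t1_space"
  assumes "finite S"
  shows "eventually (\<lambda>t. t \<notin> S) (at s within T)"
proof -
  \<comment> \<open>\<open>s\<close> is kept in the open set even if it belongs to \<open>S\<close>,
    because \<open>at s within T\<close> omits it anyway.\<close>
  have "open (- (S - {s}))"
    using assms by (intro open_Compl finite_imp_closed) auto
  then show ?thesis
    unfolding eventually_at_topological by (intro exI[of _ "- (S - {s})"]) auto
qed

lemma eventually_at_within_in_Icc:
  fixes s :: real
  assumes "s \<in> {t0<..<t1}"
  shows "eventually (\<lambda>t. t \<in> {t0..t1}) (at s within T)"
proof -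
  have "eventually (\<lambda>t. t \<in> {t0<..<t1}) (at s within T)"
    using assms by (auto simp: eventually_at_topological intro!: exI[of _ "{t0<..<t1}"])
  then show ?thesis by (rule eventually_mono) auto
qed

lemma KC1_add:
  assumes "t0 < t1" "x \<in> KC1 t0 t1" "y \<in> KC1 t0 t1"
  shows "(\<lambda>t. x t + y t) \<in> KC1 t0 t1"
proof -
  let ?I = "{t0..t1}"
  obtain S where S: "finite S" "S \<subseteq> {t0<..<t1}" "continuous_on ?I x"
    "\<And>t. t \<in> ?I - S \<Longrightarrow> x differentiable (at t within ?I)"
    "continuous_on (?I - S) (vel ?I x)"
    using KC1E[OF assms(2)] by metis
  obtain S' where S': "finite S'" "S' \<subseteq> {t0<..<t1}" "continuous_on ?I y"
    "\<And>t. t \<in> ?I - S' \<Longrightarrow> y differentiable (at t within ?I)"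
    "continuous_on (?I - S') (vel ?I y)"
    using KC1E[OF assms(3)] by metis
  have eq: "vel ?I (\<lambda>t. x t + y t) t = vel ?I x t + vel ?I y t" if "t \<in> ?I - (S \<union> S')" for t
    using that S(4) S'(4) by (intro vel_add[OF assms(1)]) auto
  have lim: "\<exists>l. (vel ?I (\<lambda>t. x t + y t) \<longlongrightarrow> l) (at s within T)"
    if "\<exists>l. (vel ?I x \<longlongrightarrow> l) (at s within T)" "\<exists>l. (vel ?I y \<longlongrightarrow> l) (at s within T)"
      "s \<in> {t0<..<t1}" for s T
  proof -
    obtain l l' where l: "(vel ?I x \<longlongrightarrow> l) (at s within T)" "(vel ?I y \<longlongrightarrow> l') (at s within T)"
      using \<open>\<exists>l. (vel ?I x \<longlongrightarrow> l) (at s within T)\<close> \<open>\<exists>l. (vel ?I y \<longlongrightarrow> l) (at s within T)\<close> by blast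
    \<comment> \<open>The sum rule for velocities can fail only on the finite set
      \<open>S \<union> S'\<close>, and a finite set does not affect a limit.\<close>
    have "eventually (\<lambda>t. vel ?I x t + vel ?I y t = vel ?I (\<lambda>t. x t + y t) t) (at s within T)"
      using eventually_at_within_notin_finite[OF finite_UnI[OF S(1) S'(1)], of s T]
        eventually_at_within_in_Icc[OF \<open>s \<in> {t0<..<t1}\<close>, of T]
      by eventually_elim (use eq in auto)
    then show ?thesis
      using Lim_transform_eventually[OF tendsto_add[OF l]] by blast
  qed
  show ?thesis
  proof (rule KC1I[of "S \<union> S'"])
    show "continuous_on (?I - (S \<union> S')) (vel ?I (\<lambda>t. x t + y t))"
    proof (subst continuous_on_cong[OF refl eq])
      show "continuous_on (?I - (S \<union> S')) (\<lambda>t. vel ?I x t + vel ?I y t)"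
        by (intro continuous_on_add continuous_on_subset[OF S(5)] continuous_on_subset[OF S'(5)]) auto
    qed
    show "\<exists>l. (vel ?I (\<lambda>t. x t + y t) \<longlongrightarrow> l) (at_left s)" if "s \<in> S \<union> S'" for s
      using that S(2) S'(2) by (intro lim KC1_vel_one_sided_limits assms) auto
    show "\<exists>l. (vel ?I (\<lambda>t. x t + y t) \<longlongrightarrow> l) (at_right s)" if "s \<in> S \<union> S'" for s
      using that S(2) S'(2) by (intro lim KC1_vel_one_sided_limits assms) auto
    show "(\<lambda>t. x t + y t) differentiable (at t within ?I)" if "t \<in> ?I - (S \<union> S')" for t
      using that by (intro differentiable_add S(4) S'(4)) auto
    show "continuous_on ?I (\<lambda>t. x t + y t)"
      using S(3) S'(3) by (rule continuous_on_add)
    show "finite (S \<union> S')" "S \<union> S' \<subseteq> {t0<..<t1}"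
      using S(1,2) S'(1,2) by auto
  qed
qed

section \<open>Affine functions and ramps as piecewise smooth functions\<close>

lemma ramp_has_vector_derivative:
  fixes z :: "'a::real_normed_vector"
  assumes "t \<noteq> c"
  shows "((\<lambda>t. max 0 (t - c) *\<^sub>R z) has_vector_derivative (if t < c then 0 else z)) (at t)"
proof (cases "t < c")
  case True
  have "((\<lambda>t. max 0 (t - c) *\<^sub>R z) has_vector_derivative 0) (at t)"
    by (rule has_vector_derivative_transform_within_open[of "\<lambda>_. 0" _ _ "{..<c}"]) (use True in auto)
  with True show ?thesis by simp
next
  case False
  have "((\<lambda>t. (t - c) *\<^sub>R z) has_vector_derivative z) (at t)"
    by (auto intro!: derivative_eq_intros)
  then have "((\<lambda>t. max 0 (t - c) *\<^sub>R z) has_vector_derivative z) (at t)"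
    by (rule has_vector_derivative_transform_within_open[of _ _ _ "{c<..}"]) (use False assms in auto)
  with False show ?thesis by simp
qed

lemma KC1_affine:
  fixes z :: "'a::real_normed_vector"
  assumes "t0 < t1" "\<And>t. t \<in> {t0..t1} \<Longrightarrow> x t = (t - c) *\<^sub>R z"
  shows "x \<in> KC1 t0 t1"
proof -
  have D: "(x has_vector_derivative z) (at t within {t0..t1})" if "t \<in> {t0..t1}" for t
  proof (rule has_vector_derivative_transform[OF that])
    show "((\<lambda>t. (t - c) *\<^sub>R z) has_vector_derivative z) (at t within {t0..t1})"
      by (auto intro!: derivative_eq_intros)
  qed (use assms(2) in auto)
  show ?thesis
  proof (rule KC1I[of "{}"])
    show "continuous_on {t0..t1} x"
      unfolding continuous_on_eq_continuous_within
      using D has_vector_derivative_continuous by blast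
    have "continuous_on {t0..t1} (\<lambda>_. z)" by simp
    then show "continuous_on ({t0..t1} - {}) (vel {t0..t1} x)"
      using continuous_on_eq[of "{t0..t1}" "\<lambda>_. z" "vel {t0..t1} x"] vel_eqI[OF assms(1) _ D] by simp
  qed (auto intro: differentiableI_vector[OF D])
qed

text \<open>Ramps are the building blocks of hats: together with closure under sums, only a single
  kink has to be analysed.\<close>

lemma KC1_ramp:
  fixes z :: "'a::real_normed_vector"
  assumes "t0 < t1" "c \<in> {t0..t1}"
  shows "(\<lambda>t. max 0 (t - c) *\<^sub>R z) \<in> KC1 t0 t1" (is "?x \<in> _")
proof -
  \<comment> \<open>Exceptional points of \<open>KC1\<close> must be interior. A kink at an end
    point is therefore treated as no kink: the ramp is then affine on the whole interval.\<close>
  consider "c = t0" | "c = t1" | "c \<in> {t0<..<t1}" using assms by fastforce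
  then show ?thesis
  proof cases
    case 1
    then show ?thesis by (intro KC1_affine[of _ _ _ t0 z] assms) auto
  next
    case 2
    \<comment> \<open>Here the ramp vanishes on \<open>{t0..t1}\<close>, so the slope is 0.\<close>
    then show ?thesis by (intro KC1_affine[of _ _ _ t0 0] assms) auto
  next
    case 3
    have D: "(?x has_vector_derivative (if t < c then 0 else z)) (at t within {t0..t1})"
      if "t \<noteq> c" for t
      using ramp_has_vector_derivative[OF that] by (rule has_vector_derivative_at_within)
    have v: "vel {t0..t1} ?x t = (if t < c then 0 else z)" if "t \<in> {t0..t1} - {c}" for t
      using that D by (intro vel_eqI assms) auto
    show ?thesis
    proof (rule KC1I[of "{c}"])
      show "continuous_on {t0..t1} ?x" by (intro continuous_intros)
      have "continuous_on ({..<c} \<union> {c<..}) (\<lambda>t. if t < c then 0 else z)"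
        by (rule continuous_on_open_Un) (auto cong: continuous_on_cong_simp)
      then have "continuous_on ({t0..t1} - {c}) (\<lambda>t. if t < c then 0 else z)"
        by (rule continuous_on_subset) auto
      then show "continuous_on ({t0..t1} - {c}) (vel {t0..t1} ?x)"
        by (subst continuous_on_cong[OF refl v]) auto
      have "(vel {t0..t1} ?x \<longlongrightarrow> 0) (at_left c)"
      proof (rule Lim_transform_eventually[OF tendsto_const])
        show "eventually (\<lambda>t. 0 = vel {t0..t1} ?x t) (at_left c)"
          unfolding eventually_at_left_field using 3 v by (auto intro!: exI[of _ t0])
      qed
      moreover have "(vel {t0..t1} ?x \<longlongrightarrow> z) (at_right c)"
      proof (rule Lim_transform_eventually[OF tendsto_const])
        show "eventually (\<lambda>t. z = vel {t0..t1} ?x t) (at_right c)"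
          unfolding eventually_at_right_field using 3 v by (auto intro!: exI[of _ t1])
      qed
      ultimately show "\<exists>l. (vel {t0..t1} ?x \<longlongrightarrow> l) (at_left s)" "\<exists>l. (vel {t0..t1} ?x \<longlongrightarrow> l) (at_right s)"
        if "s \<in> {c}" for s
        using that by auto
      show "?x differentiable (at t within {t0..t1})" if "t \<in> {t0..t1} - {c}" for t
        using D[of t] that by (auto intro: differentiableI_vector)
    qed (use 3 in auto)
  qed
qed

section \<open>Boundedness and integrability along piecewise smooth curves\<close>

text \<open>Finite subcover of \<open>K\<close>. A local bound is demanded near every point of
  \<open>K\<close>, also near those missing from \<open>A\<close>; this makes up for
  \<open>A\<close> possibly not being compact.\<close>

lemma bounded_image_if_locally_bounded:
  fixes f :: "'a::metric_space \<Rightarrow> 'b::real_normed_vector"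
  assumes "compact K" "A \<subseteq> K"
    and "\<And>t. t \<in> K \<Longrightarrow> \<exists>B. eventually (\<lambda>s. s \<in> A \<longrightarrow> norm (f s) \<le> B) (nhds t)"
  shows "bounded (f ` A)"
proof -
  have "\<exists>U. open U \<and> t \<in> U \<and> bounded (f ` (U \<inter> A))" if "t \<in> K" for t
  proof -
    obtain B U where "open U" "t \<in> U" "\<And>s. s \<in> U \<Longrightarrow> s \<in> A \<longrightarrow> norm (f s) \<le> B"
      using assms(3)[OF \<open>t \<in> K\<close>] unfolding eventually_nhds by metis
    then show ?thesis
      unfolding bounded_iff by (intro exI[of _ U]) auto
  qed
  then obtain U where U: "\<And>t. t \<in> K \<Longrightarrow> open (U t)" "\<And>t. t \<in> K \<Longrightarrow> t \<in> U t"
      "\<And>t. t \<in> K \<Longrightarrow> bounded (f ` (U t \<inter> A))"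
    by metis
  have cover: "K \<subseteq> (\<Union>t\<in>K. U t)" using U(2) by blast
  obtain C where C: "C \<subseteq> K" "finite C" "K \<subseteq> (\<Union>t\<in>C. U t)"
    by (rule compactE_image[OF assms(1) U(1) cover])
  have "bounded (\<Union>t\<in>C. f ` (U t \<inter> A))"
    using C(1,2) U(3) by (intro bounded_UN ballI) auto
  then show ?thesis
    by (rule bounded_subset) (use C(3) assms(2) in blast)
qed

lemma eventually_norm_le_of_tendsto:
  fixes f :: "'a \<Rightarrow> 'b::real_normed_vector"
  assumes "(f \<longlongrightarrow> l) F"
  shows "eventually (\<lambda>s. norm (f s) \<le> norm l + 1) F"
proof -
  have "eventually (\<lambda>s. norm (f s) < norm l + 1) F"
    using order_tendstoD(2)[OF tendsto_norm[OF assms], of "norm l + 1"] by simp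
  then show ?thesis by (rule eventually_mono) auto
qed

text \<open>Off \<open>S\<close> the local bounds come from continuity, near a point of
  \<open>S\<close> from the two one-sided limits; the value at that point itself is
  excluded.\<close>

lemma bounded_image_off_finite:
  fixes t0 t1 :: real and f :: "real \<Rightarrow> 'a::real_normed_vector"
  assumes "finite S" "continuous_on ({t0..t1} - S) f"
    "\<And>s. s \<in> S \<Longrightarrow> \<exists>l. (f \<longlongrightarrow> l) (at_left s)"
    "\<And>s. s \<in> S \<Longrightarrow> \<exists>l. (f \<longlongrightarrow> l) (at_right s)"
  shows "bounded (f ` ({t0..t1} - S))"
proof (rule bounded_image_if_locally_bounded[of "{t0..t1}"])
  fix t assume t: "t \<in> {t0..t1}"
  let ?A = "{t0..t1} - S"
  show "\<exists>B. eventually (\<lambda>s. s \<in> ?A \<longrightarrow> norm (f s) \<le> B) (nhds t)"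
  proof (cases "t \<in> S")
    case True
    obtain l r where lr: "(f \<longlongrightarrow> l) (at_left t)" "(f \<longlongrightarrow> r) (at_right t)"
      using assms(3,4) True by blast
    let ?B = "max (norm l) (norm r) + 1"
    have "eventually (\<lambda>s. norm (f s) \<le> ?B) (at_left t)"
      using eventually_norm_le_of_tendsto[OF lr(1)] by (rule eventually_mono) auto
    moreover have "eventually (\<lambda>s. norm (f s) \<le> ?B) (at_right t)"
      using eventually_norm_le_of_tendsto[OF lr(2)] by (rule eventually_mono) auto
    ultimately have "eventually (\<lambda>s. norm (f s) \<le> ?B) (at t)"
      by (simp add: eventually_at_split)
    then have "eventually (\<lambda>s. s \<in> ?A \<longrightarrow> norm (f s) \<le> ?B) (nhds t)"
      unfolding eventually_at_filter by (rule eventually_mono) (use True in auto)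
    then show ?thesis by blast
  next
    case False
    then have "(f \<longlongrightarrow> f t) (at t within ?A)"
      using assms(2) t by (auto simp: continuous_on_def)
    from eventually_norm_le_of_tendsto[OF this]
    have "eventually (\<lambda>s. s \<in> ?A \<longrightarrow> norm (f s) \<le> norm (f t) + 1) (nhds t)"
      unfolding eventually_at_filter by (rule eventually_mono) auto
    then show ?thesis by blast
  qed
qed auto

text \<open>Off the finite exceptional set the velocity is bounded, so the arguments of
  \<open>f\<close> stay in a compact set and the integrand is bounded; it is measurable because it
  is continuous there. This is what allows integrals in \<open>J\<close> to be subtracted.\<close>

lemma KC1_composition_integrable:
  fixes f :: "real \<times> 'a::euclidean_space \<times> 'a \<Rightarrow> real"
  assumes "t0 < t1" "continuous_on ({t0..t1} \<times> UNIV \<times> UNIV) f" "x \<in> KC1 t0 t1"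
  shows "(\<lambda>t. f (t, x t, vel {t0..t1} x t)) integrable_on {t0..t1}"
proof -
  let ?I = "{t0..t1}" and ?v = "vel {t0..t1} x"
  obtain S where S: "finite S" "S \<subseteq> {t0<..<t1}" "continuous_on ?I x" "continuous_on (?I - S) ?v"
    using KC1E[OF assms(3)] by metis
  have "bounded (?v ` (?I - S))"
    using S(2) KC1_vel_one_sided_limits[OF assms(3)] by (intro bounded_image_off_finite[OF S(1) S(4)]) auto
  then obtain B where B: "\<And>t. t \<in> ?I - S \<Longrightarrow> ?v t \<in> cball 0 B"
    unfolding bounded_iff by (metis dist_0_norm image_eqI mem_cball)
  have "compact (x ` ?I)" using S(3) by (intro compact_continuous_image) auto
  then have "compact (?I \<times> x ` ?I \<times> cball (0::'a) B)" by (intro compact_Times) auto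
  then have "bounded (f ` (?I \<times> x ` ?I \<times> cball 0 B))"
    by (intro compact_imp_bounded compact_continuous_image continuous_on_subset[OF assms(2)]) auto
  then obtain M where M: "\<And>z. z \<in> ?I \<times> x ` ?I \<times> cball 0 B \<Longrightarrow> \<bar>f z\<bar> \<le> M"
    unfolding bounded_iff by (metis image_eqI real_norm_def)
  have cont: "continuous_on (?I - S) (\<lambda>t. f (t, x t, ?v t))"
    by (rule continuous_on_compose2[OF assms(2)], intro continuous_on_Pair continuous_on_id S(4))
      (auto intro: continuous_on_subset[OF S(3)])
  have meas: "?I - S \<in> sets lebesgue"
    using finite_imp_closed[OF S(1)] by (intro sets.Diff lmeasurable_cbox[of t0 t1, unfolded cbox_interval, THEN fmeasurableD]) auto
  have int: "(\<lambda>_. M) integrable_on (?I - S)"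
    by (rule integrable_spike_set[of _ ?I]) (auto intro!: negligible_subset[OF negligible_finite[OF S(1)]])
  have le: "\<bar>f (t, x t, ?v t)\<bar> \<le> M" if "t \<in> ?I - S" for t
    using that B[OF that] by (intro M) auto
  have "(\<lambda>t. f (t, x t, ?v t)) integrable_on (?I - S)"
    using continuous_imp_measurable_on_sets_lebesgue[OF cont meas] int le meas
    by (rule measurable_bounded_by_integrable_imp_integrable_real)
  then show ?thesis
    by (rule integrable_spike_set) (auto intro!: negligible_subset[OF negligible_finite[OF S(1)]])
qed

section \<open>Lagrangians of class \<open>C\<^sup>1\<close>\<close>

text \<open>\<open>grad\<close> is a definite description, so existence and uniqueness of the
  gradient have to be established first. The Riesz representative of \<open>f'\<close> is assembled
  from its values on \<open>Basis\<close>.\<close>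

lemma inner_grad:
  fixes f :: "'a::euclidean_space \<Rightarrow> real"
  assumes "(f has_derivative f') (at x)"
  shows "f' h = grad f x \<bullet> h"
proof -
  interpret f': bounded_linear f' using assms by (rule has_derivative_bounded_linear)
  define D where "D = (\<Sum>b\<in>Basis. f' b *\<^sub>R b)"
  have D: "f' h = h \<bullet> D" for h
  proof -
    have "f' h = f' (\<Sum>b\<in>Basis. (h \<bullet> b) *\<^sub>R b)" by (simp add: euclidean_representation)
    also have "\<dots> = (\<Sum>b\<in>Basis. (h \<bullet> b) * f' b)" by (simp add: f'.sum f'.scaleR)
    also have "\<dots> = h \<bullet> D" by (simp add: D_def inner_sum_right mult.commute)
    finally show ?thesis .
  qed
  have "f' = (\<lambda>h. h \<bullet> D)" using D by (rule ext)
  then have GD: "GDERIV f x :> D" using assms by (simp add: gderiv_def)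
  have unique: "D' = D" if "GDERIV f x :> D'" for D'
  proof -
    have "(\<lambda>h. h \<bullet> D') = (\<lambda>h. h \<bullet> D)"
      using that GD has_derivative_unique unfolding gderiv_def by blast
    then have "h \<bullet> D' = h \<bullet> D" for h by (rule fun_cong)
    then show ?thesis by (metis inner_commute vector_eq_rdot)
  qed
  have "grad f x = D"
    unfolding grad_def by (rule the_equality) (fact GD unique)+
  then show ?thesis using D by (simp add: inner_commute)
qed

text \<open>Carries the derivative witnessing \<open>C1_on\<close> as a parameter \<open>dL\<close>;
  the partial gradients are read off from it, so that all differentiation of \<open>L\<close> goes
  through one chain rule.\<close>

locale C1_lagrangian =
  fixes T :: "real set" and L :: "'n::finite lagrangian"
    and dL :: "real \<times> (real ^ 'n) \<times> (real ^ 'n) \<Rightarrow> (real \<times> (real ^ 'n) \<times> (real ^ 'n)) \<Rightarrow>\<^sub>L real"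
  assumes open_T: "open T"
    and has_derivative_L:
      "t \<in> T \<Longrightarrow> ((\<lambda>(t, x, v). L t x v) has_derivative blinfun_apply (dL (t, x, v))) (at (t, x, v))"
    and continuous_dL: "continuous_on (T \<times> UNIV \<times> UNIV) dL"
begin

lemma has_derivative_L_comp:
  assumes "f y \<in> T" "(f has_derivative f') (at y within S)"
    "(g has_derivative g') (at y within S)" "(h has_derivative h') (at y within S)"
  shows "((\<lambda>y. L (f y) (g y) (h y)) has_derivative (\<lambda>z. dL (f y, g y, h y) (f' z, g' z, h' z))) (at y within S)"
proof -
  have "((\<lambda>y. (f y, g y, h y)) has_derivative (\<lambda>z. (f' z, g' z, h' z))) (at y within S)"
    using assms by (intro has_derivative_Pair)
  from has_derivative_compose[OF this has_derivative_L[OF assms(1)]] show ?thesis by simp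
qed

lemma dL_x: "t \<in> T \<Longrightarrow> dL (t, x, v) (0, h, 0) = L_x L t x v \<bullet> h"
  unfolding L_x_def
  by (rule inner_grad[where f = "\<lambda>y. L t y v" and f' = "\<lambda>h. dL (t, x, v) (0, h, 0)"])
     (use has_derivative_L_comp[of "\<lambda>_. t" x "\<lambda>_. 0" UNIV "\<lambda>y. y" "\<lambda>h. h" "\<lambda>_. v" "\<lambda>_. 0"] in auto)

lemma dL_v: "t \<in> T \<Longrightarrow> dL (t, x, v) (0, 0, h) = L_v L t x v \<bullet> h"
  unfolding L_v_def
  by (rule inner_grad[where f = "\<lambda>w. L t x w" and f' = "\<lambda>h. dL (t, x, v) (0, 0, h)"])
     (use has_derivative_L_comp[of "\<lambda>_. t" v "\<lambda>_. 0" UNIV "\<lambda>_. x" "\<lambda>_. 0" "\<lambda>w. w" "\<lambda>h. h"] in auto)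

lemma dL_xv:
  assumes "t \<in> T"
  shows "dL (t, x, v) (0, h, k) = L_x L t x v \<bullet> h + L_v L t x v \<bullet> k"
proof -
  have "dL (t, x, v) (0, h, k) = dL (t, x, v) ((0, h, 0) + (0, 0, k))" by simp
  also have "\<dots> = dL (t, x, v) (0, h, 0) + dL (t, x, v) (0, 0, k)" by (rule blinfun.add_right)
  finally show ?thesis using assms by (simp add: dL_x dL_v)
qed

lemma continuous_on_L: "continuous_on (T \<times> UNIV \<times> UNIV) (\<lambda>(t, x, v). L t x v)"
  by (rule has_derivative_continuous_on, rule has_derivative_at_withinI[where s = "T \<times> UNIV \<times> UNIV"])
    (use has_derivative_L in auto)

text \<open>Each component of the gradient is \<open>dL\<close> applied to a fixed vector, and it
  inherits continuity from the operator norm continuity of \<open>dL\<close>.\<close>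

lemma continuous_on_L_x: "continuous_on (T \<times> UNIV \<times> UNIV) (\<lambda>(t, x, v). L_x L t x v)"
proof (subst continuous_on_componentwise, intro ballI)
  fix i :: "real ^ 'n"
  have "continuous_on (T \<times> UNIV \<times> UNIV) (\<lambda>z. dL z (0, i, 0))"
    by (intro continuous_intros continuous_dL)
  then show "continuous_on (T \<times> UNIV \<times> UNIV) (\<lambda>z. (case z of (t, x, v) \<Rightarrow> L_x L t x v) \<bullet> i)"
    by (rule continuous_on_eq) (auto simp: dL_x)
qed

lemma continuous_on_L_v: "continuous_on (T \<times> UNIV \<times> UNIV) (\<lambda>(t, x, v). L_v L t x v)"
proof (subst continuous_on_componentwise, intro ballI)
  fix i :: "real ^ 'n"
  have "continuous_on (T \<times> UNIV \<times> UNIV) (\<lambda>z. dL z (0, 0, i))"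
    by (intro continuous_intros continuous_dL)
  then show "continuous_on (T \<times> UNIV \<times> UNIV) (\<lambda>z. (case z of (t, x, v) \<Rightarrow> L_v L t x v) \<bullet> i)"
    by (rule continuous_on_eq) (auto simp: dL_v)
qed

lemma tendsto_L_x_comp:
  assumes "(f \<longlongrightarrow> t) F" "(g \<longlongrightarrow> x) F" "(h \<longlongrightarrow> v) F" "t \<in> T"
  shows "((\<lambda>y. L_x L (f y) (g y) (h y)) \<longlongrightarrow> L_x L t x v) F"
proof -
  have "open (T \<times> (UNIV :: (real ^ 'n) set) \<times> (UNIV :: (real ^ 'n) set))"
    by (intro open_Times open_T open_UNIV)
  then have "isCont (\<lambda>(t, x, v). L_x L t x v) (t, x, v)"
    using continuous_on_L_x assms(4) by (auto simp: continuous_on_eq_continuous_at)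
  from isCont_tendsto_compose[OF this tendsto_Pair[OF assms(1) tendsto_Pair[OF assms(2,3)]]]
  show ?thesis by simp
qed

lemma continuous_on_L_comp [continuous_intros]:
  assumes "continuous_on A f" "continuous_on A g" "continuous_on A h" "\<And>y. y \<in> A \<Longrightarrow> f y \<in> T"
  shows "continuous_on A (\<lambda>y. L (f y) (g y) (h y))"
  using continuous_on_compose2[OF continuous_on_L continuous_on_Pair[OF assms(1) continuous_on_Pair[OF assms(2,3)]]] assms(4)
  by auto

lemma continuous_on_L_x_comp [continuous_intros]:
  assumes "continuous_on A f" "continuous_on A g" "continuous_on A h" "\<And>y. y \<in> A \<Longrightarrow> f y \<in> T"
  shows "continuous_on A (\<lambda>y. L_x L (f y) (g y) (h y))"
  using continuous_on_compose2[OF continuous_on_L_x continuous_on_Pair[OF assms(1) continuous_on_Pair[OF assms(2,3)]]] assms(4)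
  by auto

lemma continuous_on_L_v_comp [continuous_intros]:
  assumes "continuous_on A f" "continuous_on A g" "continuous_on A h" "\<And>y. y \<in> A \<Longrightarrow> f y \<in> T"
  shows "continuous_on A (\<lambda>y. L_v L (f y) (g y) (h y))"
  using continuous_on_compose2[OF continuous_on_L_v continuous_on_Pair[OF assms(1) continuous_on_Pair[OF assms(2,3)]]] assms(4)
  by auto

end

text \<open>At \<open>r = 0\<close> this is the Weierstrass excess function. On a leg of a hat with
  slope \<open>z\<close> and zero at \<open>c\<close> the displacement is \<open>(t - c)\<close>
  times \<open>z\<close>, so a scalar \<open>r\<close> suffices to describe it. The velocity
  \<open>u\<close> is a separate argument, because at an angular point a one-sided velocity has to
  replace \<open>vel\<close>.\<close>

definition excess ::
  "'n::finite lagrangian \<Rightarrow> (real \<Rightarrow> real ^ 'n) \<Rightarrow> (real \<Rightarrow> real ^ 'n) \<Rightarrow> real \<Rightarrow> real \<Rightarrow> real ^ 'n \<Rightarrow> real" where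
  "excess L x u t r z = L t (x t + r *\<^sub>R z) (u t + z) - L t (x t) (u t)
     - r * (L_x L t (x t) (u t) \<bullet> z) - L_v L t (x t) (u t) \<bullet> z"

text \<open>Describes one leg of a hat: \<open>c\<close> is the end of the leg at which the hat
  vanishes, the left one for the first leg and the right one for the second.\<close>

definition increment ::
  "'n::finite lagrangian \<Rightarrow> (real \<Rightarrow> real ^ 'n) \<Rightarrow> (real \<Rightarrow> real ^ 'n) \<Rightarrow> real \<Rightarrow> real ^ 'n \<Rightarrow> real \<Rightarrow> real" where
  "increment L x u c z t = L t (x t + (t - c) *\<^sub>R z) (u t + z) - L t (x t) (u t)"

definition first_variation ::
  "'n::finite lagrangian \<Rightarrow> (real \<Rightarrow> real ^ 'n) \<Rightarrow> (real \<Rightarrow> real ^ 'n) \<Rightarrow> real \<Rightarrow> real ^ 'n \<Rightarrow> real \<Rightarrow> real" where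
  "first_variation L x u c z t = (t - c) * (L_x L t (x t) (u t) \<bullet> z) + L_v L t (x t) (u t) \<bullet> z"

lemma excess_eq: "excess L x u t (t - c) z = increment L x u c z t - first_variation L x u c z t"
  by (simp add: excess_def increment_def first_variation_def)

lemma increment_0 [simp]: "increment L x u c 0 = (\<lambda>t. 0)"
  by (simp add: increment_def fun_eq_iff)

context C1_lagrangian
begin

lemma continuous_on_increment:
  assumes "A \<subseteq> T" "continuous_on A x" "continuous_on A u"
  shows "continuous_on A (increment L x u c z)"
  unfolding increment_def using assms by (intro continuous_intros) auto

lemma continuous_on_first_variation:
  assumes "A \<subseteq> T" "continuous_on A x" "continuous_on A u"
  shows "continuous_on A (first_variation L x u c z)"
  unfolding first_variation_def using assms by (intro continuous_intros) auto

text \<open>Differentiation under the integral sign with respect to the scale \<open>s\<close> of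
  the leg. The Leibniz rule asks for joint continuity in scale and time, hence \<open>u\<close> is
  continuous on the closed interval.\<close>

lemma integral_increment_has_derivative:
  assumes "{p..q} \<subseteq> T" "continuous_on {p..q} x" "continuous_on {p..q} u"
  shows "((\<lambda>s. integral {p..q} (increment L x u c (s *\<^sub>R z))) has_real_derivative
           integral {p..q} (first_variation L x u c z)) (at 0)"
proof -
  \<comment> \<open>The derivative of the integrand at an arbitrary scale \<open>s\<close>; at
    \<open>s = 0\<close> it is \<open>first_variation\<close>.\<close>
  define fs where "fs s t = (t - c) * (L_x L t (x t + (t - c) *\<^sub>R s *\<^sub>R z) (u t + s *\<^sub>R z) \<bullet> z)
     + L_v L t (x t + (t - c) *\<^sub>R s *\<^sub>R z) (u t + s *\<^sub>R z) \<bullet> z" for s t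
  have "((\<lambda>s. integral (cbox p q) (\<lambda>t. increment L x u c (s *\<^sub>R z) t)) has_field_derivative
           integral (cbox p q) (fs 0)) (at 0 within UNIV)"
  proof (rule leibniz_rule_field_derivative)
    fix s t :: real assume "t \<in> cbox p q"
    then have t: "t \<in> T" using assms(1) by auto
    have "((\<lambda>s. L t (x t + (t - c) *\<^sub>R s *\<^sub>R z) (u t + s *\<^sub>R z)) has_derivative
       (\<lambda>h. dL (t, x t + (t - c) *\<^sub>R s *\<^sub>R z, u t + s *\<^sub>R z) (0, (t - c) *\<^sub>R h *\<^sub>R z, h *\<^sub>R z))) (at s)"
      by (rule has_derivative_L_comp) (use t in \<open>auto intro!: derivative_eq_intros\<close>)
    then have "((\<lambda>s. increment L x u c (s *\<^sub>R z) t) has_derivative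
       (\<lambda>h. dL (t, x t + (t - c) *\<^sub>R s *\<^sub>R z, u t + s *\<^sub>R z) (0, (t - c) *\<^sub>R h *\<^sub>R z, h *\<^sub>R z))) (at s)"
      unfolding increment_def by (auto intro!: derivative_eq_intros)
    moreover have "(\<lambda>h. dL (t, x t + (t - c) *\<^sub>R s *\<^sub>R z, u t + s *\<^sub>R z) (0, (t - c) *\<^sub>R h *\<^sub>R z, h *\<^sub>R z))
        = (*) (fs s t)"
      by (auto simp: dL_xv t fs_def fun_eq_iff algebra_simps)
    ultimately show "((\<lambda>s. increment L x u c (s *\<^sub>R z) t) has_field_derivative fs s t) (at s within UNIV)"
      unfolding has_field_derivative_def by simp
  next
    fix s :: real
    show "increment L x u c (s *\<^sub>R z) integrable_on cbox p q"
      using continuous_on_increment[OF assms] by (simp add: integrable_continuous_interval)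
  next
    have "continuous_on (UNIV \<times> cbox p q) (\<lambda>y. x (snd y))" "continuous_on (UNIV \<times> cbox p q) (\<lambda>y. u (snd y))"
      using assms by (auto intro!: continuous_on_compose2[OF assms(2)] continuous_on_compose2[OF assms(3)] continuous_intros)
    then show "continuous_on (UNIV \<times> cbox p q) (\<lambda>(s, t). fs s t)"
      unfolding fs_def split_beta using assms(1) by (intro continuous_intros) auto
  qed auto
  moreover have "fs 0 = first_variation L x u c z"
    by (simp add: fun_eq_iff fs_def first_variation_def)
  ultimately show ?thesis by simp
qed

end

section \<open>Hat functions\<close>

text \<open>A sum of ramps whose coefficients are the jumps of the slope at \<open>p\<close>,
  \<open>m\<close> and \<open>q\<close>; in this form \<open>KC1_add\<close> and
  \<open>KC1_ramp\<close> give membership in \<open>KC1\<close>.\<close>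

definition hat :: "real \<Rightarrow> real \<Rightarrow> real \<Rightarrow> 'a \<Rightarrow> 'a \<Rightarrow> real \<Rightarrow> 'a::real_normed_vector" where
  "hat p m q y z t = max 0 (t - p) *\<^sub>R y + max 0 (t - m) *\<^sub>R (z - y) + max 0 (t - q) *\<^sub>R (- z)"

definition hat_slope :: "real \<Rightarrow> real \<Rightarrow> real \<Rightarrow> 'a \<Rightarrow> 'a \<Rightarrow> real \<Rightarrow> 'a::real_normed_vector" where
  "hat_slope p m q y z t = (if t \<in> {p<..<m} then y else if t \<in> {m<..<q} then z else 0)"

text \<open>By \<open>closed\<close> the changes along the two legs cancel, so the hat vanishes
  again from \<open>q\<close> on.\<close>

locale hat_data =
  fixes p m q :: real and y z :: "'a::real_normed_vector"
  assumes pm: "p < m" and mq: "m < q" and closed: "(m - p) *\<^sub>R y + (q - m) *\<^sub>R z = 0"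
begin

lemma hat_left: "t \<le> p \<Longrightarrow> hat p m q y z t = 0"
  using pm mq by (simp add: hat_def)

lemma hat_up: "p \<le> t \<Longrightarrow> t \<le> m \<Longrightarrow> hat p m q y z t = (t - p) *\<^sub>R y"
  using pm mq by (simp add: hat_def)

lemma hat_down:
  assumes "m \<le> t" "t \<le> q"
  shows "hat p m q y z t = (t - q) *\<^sub>R z"
proof -
  have "hat p m q y z t = (t - p) *\<^sub>R y + (t - m) *\<^sub>R (z - y)"
    using assms pm mq by (simp add: hat_def)
  \<comment> \<open>Splits off the closing combination, which is zero; the second leg is then
    measured from its own zero \<open>q\<close>.\<close>
  also have "\<dots> = ((m - p) *\<^sub>R y + (q - m) *\<^sub>R z) + (t - q) *\<^sub>R z"
    by (simp add: algebra_simps)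
  finally show ?thesis by (simp add: closed)
qed

lemma hat_right:
  assumes "q \<le> t"
  shows "hat p m q y z t = 0"
proof -
  have "hat p m q y z t = (t - p) *\<^sub>R y + (t - m) *\<^sub>R (z - y) + (t - q) *\<^sub>R (- z)"
    using assms pm mq by (simp add: hat_def)
  also have "\<dots> = (m - p) *\<^sub>R y + (q - m) *\<^sub>R z"
    by (simp add: algebra_simps)
  finally show ?thesis by (simp add: closed)
qed

lemma hat_has_vector_derivative:
  assumes "t \<notin> {p, m, q}"
  shows "(hat p m q y z has_vector_derivative hat_slope p m q y z t) (at t)"
proof -
  consider "t < p" | "t \<in> {p<..<m}" | "t \<in> {m<..<q}" | "q < t"
    using assms by fastforce
  then show ?thesis
  proof cases
    case 1
    have "(hat p m q y z has_vector_derivative 0) (at t)"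
      by (rule has_vector_derivative_transform_within_open[of "\<lambda>_. 0" _ _ "{..<p}"])
        (use 1 in \<open>auto simp: hat_left\<close>)
    then show ?thesis using 1 pm mq by (simp add: hat_slope_def)
  next
    case 2
    have "((\<lambda>t. (t - p) *\<^sub>R y) has_vector_derivative y) (at t)"
      by (auto intro!: derivative_eq_intros)
    then have "(hat p m q y z has_vector_derivative y) (at t)"
      by (rule has_vector_derivative_transform_within_open[of _ _ _ "{p<..<m}"])
        (use 2 in \<open>auto simp: hat_up\<close>)
    then show ?thesis using 2 pm mq by (simp add: hat_slope_def)
  next
    case 3
    have "((\<lambda>t. (t - q) *\<^sub>R z) has_vector_derivative z) (at t)"
      by (auto intro!: derivative_eq_intros)
    then have "(hat p m q y z has_vector_derivative z) (at t)"
      by (rule has_vector_derivative_transform_within_open[of _ _ _ "{m<..<q}"])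
        (use 3 in \<open>auto simp: hat_down\<close>)
    then show ?thesis using 3 pm mq by (simp add: hat_slope_def)
  next
    case 4
    have "(hat p m q y z has_vector_derivative 0) (at t)"
      by (rule has_vector_derivative_transform_within_open[of "\<lambda>_. 0" _ _ "{q<..}"])
        (use 4 in \<open>auto simp: hat_right\<close>)
    then show ?thesis using 4 pm mq by (simp add: hat_slope_def)
  qed
qed

text \<open>A support of length at most 1 makes the hat no larger than its slopes, so that one bound
  \<open>d\<close> serves both norms in the definition of a weak minimum.\<close>

lemma norm_hat_le:
  assumes "norm y \<le> d" "norm z \<le> d" "q - p \<le> 1"
  shows "norm (hat p m q y z t) \<le> d"
proof -
  have d: "0 \<le> d" using assms(1) norm_ge_zero order_trans by blast
  have le: "norm (c *\<^sub>R w) \<le> d" if "norm w \<le> d" "\<bar>c\<bar> \<le> 1" for w :: 'a and c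
    using mult_mono[OF that(2,1)] by simp
  consider "t \<le> p" | "p \<le> t" "t \<le> m" | "m \<le> t" "t \<le> q" | "q \<le> t" by fastforce
  then show ?thesis
    by cases (use assms pm mq d in \<open>auto simp: hat_left hat_right hat_up hat_down simp del: norm_scaleR intro!: le\<close>)
qed

lemma hat_in_KC1:
  assumes "t0 \<le> p" "q \<le> t1"
  shows "hat p m q y z \<in> KC1 t0 t1"
  unfolding hat_def using assms pm mq by (intro KC1_add KC1_ramp) auto

lemma KC1_add_hat:
  assumes "t0 \<le> p" "q \<le> t1" "x \<in> KC1 t0 t1"
  shows "(\<lambda>t. x t + hat p m q y z t) \<in> KC1 t0 t1"
  using assms pm mq by (intro KC1_add hat_in_KC1) auto

lemma vel_add_hat:
  assumes "t \<in> {t0<..<t1} - {p, m, q}" "x differentiable (at t within {t0..t1})"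
  shows "vel {t0..t1} (\<lambda>t. x t + hat p m q y z t) t = vel {t0..t1} x t + hat_slope p m q y z t"
proof -
  have D: "(hat p m q y z has_vector_derivative hat_slope p m q y z t) (at t within {t0..t1})"
    by (rule has_vector_derivative_at_within[OF hat_has_vector_derivative]) (use assms(1) in auto)
  have "t0 < t1" "t \<in> {t0..t1}" using assms(1) by auto
  then show ?thesis
    using D assms(2) by (simp add: vel_add vel_eqI differentiableI_vector)
qed

text \<open>Gathers the points at which the velocity of a perturbed curve is not given by the sum
  rule: end points, kinks of the hat, angular points of \<open>x\<close>.\<close>

lemma KC1_finite_exceptions:
  assumes "x \<in> KC1 t0 t1"
  obtains N where "finite N"
    "\<And>t. t \<in> {t0..t1} - N \<Longrightarrow> t \<in> {t0<..<t1} - {p, m, q} \<and> x differentiable (at t within {t0..t1})"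
proof -
  obtain S where S: "finite S"
    "\<And>t. t \<in> {t0..t1} - S \<Longrightarrow> x differentiable (at t within {t0..t1})"
    using KC1E[OF assms] by metis
  show thesis
    by (rule that[of "S \<union> {t0, t1, p, m, q}"]) (use S in auto)
qed

text \<open>An almost everywhere bound controls \<open>esssup\<close> for measurable functions. Off
  a finite set the velocity difference is the step function \<open>hat_slope\<close>, and its
  measurability is carried over.\<close>

lemma C_Linf_norm_hat_le:
  assumes "x \<in> KC1 t0 t1" "norm y \<le> d" "norm z \<le> d" "q - p \<le> 1"
  shows "max (C_norm {t0..t1} (\<lambda>t. (x t + hat p m q y z t) - x t))
     (Linf_norm {t0..t1} (\<lambda>t. vel {t0..t1} (\<lambda>t. x t + hat p m q y z t) t - vel {t0..t1} x t)) \<le> ereal d"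
proof (rule max.boundedI)
  show "C_norm {t0..t1} (\<lambda>t. (x t + hat p m q y z t) - x t) \<le> ereal d"
    unfolding C_norm_def using norm_hat_le[OF assms(2-4)] by (auto intro!: SUP_least)
next
  let ?I = "{t0..t1}"
  let ?w = "\<lambda>t. vel ?I (\<lambda>t. x t + hat p m q y z t) t - vel ?I x t"
  obtain N where N: "finite N"
    "\<And>t. t \<in> ?I - N \<Longrightarrow> t \<in> {t0<..<t1} - {p, m, q} \<and> x differentiable (at t within ?I)"
    using KC1_finite_exceptions[OF assms(1)] by metis
  have eq: "?w t = hat_slope p m q y z t" if "t \<in> ?I - N" for t
    using N(2)[OF that] by (simp add: vel_add_hat)
  have slope: "norm (hat_slope p m q y z t) \<le> d" for t
    using assms(2,3) order_trans[OF norm_ge_zero assms(2)] by (simp add: hat_slope_def)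
  have "(\<lambda>t. ereal (norm (hat_slope p m q y z t))) =
      (\<lambda>t. if t \<in> {p<..<m} then ereal (norm y) else if t \<in> {m<..<q} then ereal (norm z) else 0)"
    by (auto simp: hat_slope_def)
  also have "\<dots> \<in> borel_measurable lebesgue"
    by (intro measurable_If_set measurable_const) auto
  finally have "(\<lambda>t. ereal (norm (hat_slope p m q y z t))) \<in> borel_measurable lebesgue" .
  then have "(\<lambda>t. ereal (norm (hat_slope p m q y z t))) \<in> borel_measurable (lebesgue_on ?I)"
    by (rule measurable_restrict_space1)
  then have meas: "(\<lambda>t. ereal (norm (?w t))) \<in> borel_measurable (lebesgue_on ?I)"
  proof (rule measurable_discrete_difference[where X = "N \<inter> ?I"])
    show "{t} \<in> sets (lebesgue_on ?I)" if "t \<in> N \<inter> ?I" for t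
      using that by (auto simp: sets_restrict_space_iff)
  qed (use N(1) eq in \<open>auto intro: countable_finite\<close>)
  have "N \<inter> ?I \<in> null_sets (lebesgue_on ?I)"
    using N(1) by (auto simp: null_sets_restrict_space intro!: negligible_finite simp flip: negligible_iff_null_sets)
  then have "AE t in lebesgue_on ?I. ereal (norm (?w t)) \<le> ereal d"
    by (rule AE_I') (use eq slope in fastforce)
  with meas show "Linf_norm ?I ?w \<le> ereal d"
    unfolding Linf_norm_def by (rule esssup_I)
qed

end

section \<open>Weak minima and the excess\<close>

context C1_lagrangian
begin

lemma J_integrand_integrable:
  assumes "t0 < t1" "{t0..t1} \<subseteq> T" "x \<in> KC1 t0 t1"
  shows "(\<lambda>t. L t (x t) (vel {t0..t1} x t)) integrable_on {t0..t1}"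
  using KC1_composition_integrable[OF assms(1) continuous_on_subset[OF continuous_on_L] assms(3)] assms(2)
  by (simp add: Sigma_mono)

text \<open>\<open>u\<close> is continuous up to \<open>p\<close> and \<open>q\<close> but is the
  velocity of \<open>x\<close> only strictly between them. This lets a hat begin or end at an
  angular point.\<close>

lemma J_add_hat:
  fixes x u :: "real \<Rightarrow> real ^ 'n"
  assumes I: "{t0..t1} \<subseteq> T" and x: "x \<in> KC1 t0 t1"
    and pq: "t0 \<le> p" "q \<le> t1" and hat: "hat_data p m q y z"
    and u: "continuous_on {p..q} u"
      "\<And>t. t \<in> {p<..<q} \<Longrightarrow> (x has_vector_derivative u t) (at t)"
  shows "J L t0 t1 (\<lambda>t. x t + hat p m q y z t) - J L t0 t1 x
    = integral {p..m} (increment L x u p y) + integral {m..q} (increment L x u q z)"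
proof -
  interpret hat_data p m q y z by (rule hat)
  let ?I = "{t0..t1}" and ?x' = "\<lambda>t. x t + hat p m q y z t"
  have t01: "t0 < t1" using pm mq pq by linarith
  have x': "?x' \<in> KC1 t0 t1" by (rule KC1_add_hat[OF pq x])
  have contx: "continuous_on ?I x" using KC1E[OF x] by metis
  obtain N where N: "finite N"
    "\<And>t. t \<in> ?I - N \<Longrightarrow> t \<in> {t0<..<t1} - {p, m, q} \<and> x differentiable (at t within ?I)"
    using KC1_finite_exceptions[OF x] by metis
  \<comment> \<open>The difference of the two integrands up to finitely many points; it is
    integrated leg by leg and extended by 0 from \<open>{p..q}\<close> to the whole
    interval.\<close>
  define D where "D t = (if t \<in> {p<..<m} then increment L x u p y t
    else if t \<in> {m<..<q} then increment L x u q z t else 0)" for t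
  have sub: "{p..m} \<subseteq> T" "{p..m} \<subseteq> {p..q}" "{m..q} \<subseteq> T" "{m..q} \<subseteq> {p..q}" "{p..q} \<subseteq> ?I"
    using I pq pm mq by auto
  have "(increment L x u p y has_integral integral {p..m} (increment L x u p y)) {p..m}"
    by (intro integrable_integral integrable_continuous_interval continuous_on_increment
        continuous_on_subset[OF contx] continuous_on_subset[OF u(1)]) (use sub in auto)
  then have "(D has_integral integral {p..m} (increment L x u p y)) {p..m}"
    by (rule has_integral_spike_finite[of "{p, m}", rotated 2]) (auto simp: D_def)
  moreover have "(increment L x u q z has_integral integral {m..q} (increment L x u q z)) {m..q}"
    by (intro integrable_integral integrable_continuous_interval continuous_on_increment
        continuous_on_subset[OF contx] continuous_on_subset[OF u(1)]) (use sub in auto)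
  then have "(D has_integral integral {m..q} (increment L x u q z)) {m..q}"
    by (rule has_integral_spike_finite[of "{m, q}", rotated 2]) (use pm in \<open>auto simp: D_def\<close>)
  ultimately have "(D has_integral
      integral {p..m} (increment L x u p y) + integral {m..q} (increment L x u q z)) {p..q}"
    by (rule has_integral_combine[rotated 2]) (use pm mq in auto)
  then have D: "(D has_integral
      integral {p..m} (increment L x u p y) + integral {m..q} (increment L x u q z)) ?I"
    by (rule has_integral_on_superset) (use sub pm mq in \<open>auto simp: D_def\<close>)
  have "L t (?x' t) (vel ?I ?x' t) - L t (x t) (vel ?I x t) = D t" if "t \<in> ?I - N" for t
  proof -
    have t: "t \<in> {t0<..<t1} - {p, m, q}" and v': "vel ?I ?x' t = vel ?I x t + hat_slope p m q y z t"
      using N(2)[OF that] vel_add_hat by auto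
    have v: "vel ?I x t = u t" if "t \<in> {p<..<q}"
      using t u(2)[OF that] by (intro vel_eqI_interior) auto
    consider "t < p" | "t \<in> {p<..<m}" | "t \<in> {m<..<q}" | "q < t"
      using t by fastforce
    then show ?thesis
      by cases (use v v' pm mq in \<open>auto simp: D_def hat_slope_def increment_def hat_left hat_up hat_down hat_right\<close>)
  qed
  then have "((\<lambda>t. L t (?x' t) (vel ?I ?x' t) - L t (x t) (vel ?I x t)) has_integral
      integral {p..m} (increment L x u p y) + integral {m..q} (increment L x u q z)) ?I"
    by (rule has_integral_spike_finite[OF N(1) _ D])
  then have "integral ?I (\<lambda>t. L t (?x' t) (vel ?I ?x' t) - L t (x t) (vel ?I x t)) =
      integral {p..m} (increment L x u p y) + integral {m..q} (increment L x u q z)"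
    by (rule integral_unique)
  then show ?thesis
    unfolding J_def
    by (simp add: integral_diff J_integrand_integrable[OF t01 I x] J_integrand_integrable[OF t01 I x'])
qed

lemma continuous_on_excess:
  assumes "A \<subseteq> T" "continuous_on A x" "continuous_on A u"
  shows "continuous_on A (\<lambda>t. excess L x u t (t - c) z)"
  unfolding excess_eq
  by (intro continuous_on_diff continuous_on_increment continuous_on_first_variation assms)

end

text \<open>\<open>d\<close> is the radius of weak minimality; it bounds the slopes of all hats used
  below.\<close>

locale weak_minimum = C1_lagrangian T L dL
  for T and L :: "'n::finite lagrangian" and dL +
  fixes t0 t1 d :: real and x0 x1 :: "real ^ 'n" and x :: "real \<Rightarrow> real ^ 'n"
  assumes I: "{t0..t1} \<subseteq> T" and adm: "admissible t0 t1 x0 x1 x"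
    and min: "\<And>x'. admissible t0 t1 x0 x1 x' \<Longrightarrow>
        max (C_norm {t0..t1} (\<lambda>t. x' t - x t))
            (Linf_norm {t0..t1} (\<lambda>t. vel {t0..t1} x' t - vel {t0..t1} x t)) \<le> ereal d \<Longrightarrow>
        J L t0 t1 x \<le> J L t0 t1 x'"
begin

lemma x_in_KC1: "x \<in> KC1 t0 t1"
  using adm by (simp add: admissible_def)

lemma continuous_on_x: "continuous_on {t0..t1} x"
  using KC1E[OF x_in_KC1] by metis

text \<open>The first variation along a hat function vanishes because \<open>x\<close> also minimizes along all its
  multiples by factors in \<open>[-1, 1]\<close>, so no Euler equation is needed.\<close>

lemma excess_integral_nonneg:
  assumes pq: "t0 \<le> p" "q \<le> t1" "q - p \<le> 1" and hat: "hat_data p m q y z"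
    and yz: "norm y \<le> d" "norm z \<le> d"
    and u: "continuous_on {p..q} u"
      "\<And>t. t \<in> {p<..<q} \<Longrightarrow> (x has_vector_derivative u t) (at t)"
  shows "0 \<le> integral {p..m} (\<lambda>t. excess L x u t (t - p) y)
            + integral {m..q} (\<lambda>t. excess L x u t (t - q) z)"
proof -
  interpret hat: hat_data p m q y z by (rule hat)
  have x: "x \<in> KC1 t0 t1" "x t0 = x0" "x t1 = x1"
    using adm by (auto simp: admissible_def)
  have sub: "{p..m} \<subseteq> T" "{m..q} \<subseteq> T" "{p..m} \<subseteq> {p..q}" "{m..q} \<subseteq> {p..q}" "{p..q} \<subseteq> {t0..t1}"
    using I pq hat.pm hat.mq by auto
  have cx: "continuous_on {p..m} x" "continuous_on {m..q} x"
    and cu: "continuous_on {p..m} u" "continuous_on {m..q} u"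
    using continuous_on_subset[OF continuous_on_x] continuous_on_subset[OF u(1)] sub(3-5) by (meson order_trans)+
  define g where "g s = integral {p..m} (increment L x u p (s *\<^sub>R y))
      + integral {m..q} (increment L x u q (s *\<^sub>R z))" for s
  define g' where "g' = integral {p..m} (first_variation L x u p y)
      + integral {m..q} (first_variation L x u q z)"
  \<comment> \<open>Scaling keeps the closing condition and, for factors in \<open>[-1, 1]\<close>,
    the bounds by \<open>d\<close>. So every scaled hat gives a competitor, and \<open>g s\<close>
    is the resulting increment of \<open>J\<close>.\<close>
  have nonneg: "0 \<le> g s" if "\<bar>s\<bar> \<le> 1" for s
  proof -
    have "(m - p) *\<^sub>R s *\<^sub>R y + (q - m) *\<^sub>R s *\<^sub>R z = s *\<^sub>R ((m - p) *\<^sub>R y + (q - m) *\<^sub>R z)"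
      by (simp add: algebra_simps)
    then interpret s: hat_data p m q "s *\<^sub>R y" "s *\<^sub>R z"
      using hat.pm hat.mq by unfold_locales (simp_all add: hat.closed)
    have s: "norm (s *\<^sub>R w) \<le> d" if "norm w \<le> d" for w :: "real ^ 'n"
      using mult_mono[OF \<open>\<bar>s\<bar> \<le> 1\<close> that] by simp
    have "admissible t0 t1 x0 x1 (\<lambda>t. x t + hat p m q (s *\<^sub>R y) (s *\<^sub>R z) t)"
      unfolding admissible_def using s.KC1_add_hat[OF pq(1,2) x(1)] x(2,3) pq
      by (simp add: s.hat_left s.hat_right)
    then have "J L t0 t1 x \<le> J L t0 t1 (\<lambda>t. x t + hat p m q (s *\<^sub>R y) (s *\<^sub>R z) t)"
      using s.C_Linf_norm_hat_le[OF x(1) s[OF yz(1)] s[OF yz(2)] pq(3)] by (rule min)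
    then show ?thesis
      unfolding g_def using J_add_hat[OF I x(1) pq(1,2) s.hat_data_axioms u] by simp
  qed
  have "(g has_real_derivative g') (at 0)"
    unfolding g_def g'_def
    by (intro derivative_intros integral_increment_has_derivative sub cx cu)
  moreover have "g 0 = 0" by (simp add: g_def)
  ultimately have g'0: "g' = 0"
    by (intro DERIV_local_min[of g g' 0 1]) (use nonneg in auto)
  have "integral {p..m} (\<lambda>t. excess L x u t (t - p) y) =
      integral {p..m} (increment L x u p y) - integral {p..m} (first_variation L x u p y)"
    unfolding excess_eq
    by (intro integral_diff integrable_continuous_interval continuous_on_increment
        continuous_on_first_variation sub cx cu)
  moreover have "integral {m..q} (\<lambda>t. excess L x u t (t - q) z) =
      integral {m..q} (increment L x u q z) - integral {m..q} (first_variation L x u q z)"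
    unfolding excess_eq
    by (intro integral_diff integrable_continuous_interval continuous_on_increment
        continuous_on_first_variation sub cx cu)
  ultimately have "integral {p..m} (\<lambda>t. excess L x u t (t - p) y)
      + integral {m..q} (\<lambda>t. excess L x u t (t - q) z) = g 1 - g'"
    by (simp add: g_def g'_def)
  with nonneg[of 1] g'0 show ?thesis by simp
qed

end

section \<open>Second order asymptotics\<close>

text \<open>Comparison with the primitive \<open>F\<close> of the bound. Two centres occur because
  time is measured from \<theta> and the displacement from the zero \<open>c\<close> of the
  leg.\<close>

lemma integral_le_affine:
  fixes f :: "real \<Rightarrow> real"
  assumes "continuous_on {a..b} f" "a \<le> b"
    and "\<And>t. t \<in> {a..b} \<Longrightarrow> f t \<le> (t - \<theta>) * A + (t - c) * B + k"
  shows "integral {a..b} f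
    \<le> ((b - \<theta>)\<^sup>2 - (a - \<theta>)\<^sup>2) / 2 * A + ((b - c)\<^sup>2 - (a - c)\<^sup>2) / 2 * B + k * (b - a)"
proof -
  define F where "F t = (t - \<theta>)\<^sup>2 / 2 * A + (t - c)\<^sup>2 / 2 * B + k * t" for t
  have "(F has_vector_derivative ((t - \<theta>) * A + (t - c) * B + k)) (at t within {a..b})" for t
    unfolding F_def
    by (auto intro!: derivative_eq_intros simp: field_simps simp flip: has_real_derivative_iff_has_vector_derivative)
  then have F: "((\<lambda>t. (t - \<theta>) * A + (t - c) * B + k) has_integral (F b - F a)) {a..b}"
    by (intro fundamental_theorem_of_calculus assms)
  have "integral {a..b} f \<le> F b - F a"
    using integrable_integral[OF integrable_continuous_interval[OF assms(1)]] F
    by (rule has_integral_le) (fact assms(3))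
  also have "F b - F a =
      ((b - \<theta>)\<^sup>2 - (a - \<theta>)\<^sup>2) / 2 * A + ((b - c)\<^sup>2 - (a - c)\<^sup>2) / 2 * B + k * (b - a)"
    by (simp add: F_def algebra_simps diff_divide_distrib)
  finally show ?thesis .
qed

lemma integral_le_const:
  fixes f :: "real \<Rightarrow> real"
  assumes "continuous_on {a..b} f" "a \<le> b" "\<And>t. t \<in> {a..b} \<Longrightarrow> f t \<le> k"
  shows "integral {a..b} f \<le> k * (b - a)"
  using integral_le_affine[OF assms(1,2), of 0 0 0 0 k] assms(3) by simp

text \<open>Unfolds Frechet differentiability at one point, with the norm of the increment estimated
  by the sum of absolute values; of the two-sided estimate the upper half is kept.\<close>

lemma has_derivative_origin_bound:
  fixes f :: "real \<Rightarrow> real \<Rightarrow> real"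
  assumes "((\<lambda>(t, r). f t r) has_derivative (\<lambda>(s, r). s * A + r * B)) (at (\<theta>, 0) within S \<times> UNIV)"
    and "f \<theta> 0 = 0" "0 < k"
  obtains \<rho> where "0 < \<rho>"
    "\<And>t r. t \<in> S \<Longrightarrow> \<bar>t - \<theta>\<bar> + \<bar>r\<bar> < \<rho> \<Longrightarrow> f t r \<le> (t - \<theta>) * A + r * B + k * (\<bar>t - \<theta>\<bar> + \<bar>r\<bar>)"
proof -
  obtain \<rho> where \<rho>: "0 < \<rho>" and b: "\<And>y. y \<in> S \<times> UNIV \<Longrightarrow> norm (y - (\<theta>, 0)) < \<rho> \<Longrightarrow>
      norm ((case y of (t, r) \<Rightarrow> f t r) - (case (\<theta>, 0) of (t, r) \<Rightarrow> f t r)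
        - (case y - (\<theta>, 0) of (s, r) \<Rightarrow> s * A + r * B)) \<le> k * norm (y - (\<theta>, 0))"
    using assms(1,3) unfolding has_derivative_within_alt by blast
  show thesis
  proof (rule that[OF \<rho>])
    fix t r assume t: "t \<in> S" and tr: "\<bar>t - \<theta>\<bar> + \<bar>r\<bar> < \<rho>"
    have n: "norm ((t, r) - (\<theta>, 0)) \<le> \<bar>t - \<theta>\<bar> + \<bar>r\<bar>"
      using norm_Pair_le[of "t - \<theta>" r] by simp
    have "norm (f t r - ((t - \<theta>) * A + r * B)) \<le> k * norm ((t, r) - (\<theta>, 0))"
      using b[of "(t, r)"] n t tr assms(2) by simp
    also have "\<dots> \<le> k * (\<bar>t - \<theta>\<bar> + \<bar>r\<bar>)"
      using n assms(3) by (intro mult_left_mono) auto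
    finally show "f t r \<le> (t - \<theta>) * A + r * B + k * (\<bar>t - \<theta>\<bar> + \<bar>r\<bar>)" by simp
  qed
qed

text \<open>Integrate the linearizations at \<open>(\<theta>, 0)\<close>. On the first piece the
  time term gives \<open>e^2 (b^2 - a^2) A / 2\<close> and the displacement
  \<open>e^2 (b - a)^2 B / 2\<close>; on the second the displacement is nonpositive, whence the
  minus sign before \<open>B'\<close>. The error is \<open>o(e^2)\<close>; divide by
  \<open>e^2\<close> and let \<open>e\<close> tend to 0.\<close>

lemma two_piece_second_order:
  fixes f g :: "real \<Rightarrow> real \<Rightarrow> real"
  assumes ab: "a < b" and bc: "b < c" and emax: "0 < emax"
    and f: "((\<lambda>(t, r). f t r) has_derivative (\<lambda>(s, r). s * A + r * B)) (at (\<theta>, 0) within S \<times> UNIV)" "f \<theta> 0 = 0"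
    and g: "((\<lambda>(t, r). g t r) has_derivative (\<lambda>(s, r). s * A' + r * B')) (at (\<theta>, 0) within S \<times> UNIV)" "g \<theta> 0 = 0"
    and S: "\<And>e. 0 < e \<Longrightarrow> e < emax \<Longrightarrow> {\<theta> + a * e..\<theta> + c * e} \<subseteq> S"
    and cf: "\<And>e. 0 < e \<Longrightarrow> e < emax \<Longrightarrow>
        continuous_on {\<theta> + a * e..\<theta> + b * e} (\<lambda>t. f t (t - (\<theta> + a * e)))"
    and cg: "\<And>e. 0 < e \<Longrightarrow> e < emax \<Longrightarrow>
        continuous_on {\<theta> + b * e..\<theta> + c * e} (\<lambda>t. g t (t - (\<theta> + c * e)))"
    and nonneg: "\<And>e. 0 < e \<Longrightarrow> e < emax \<Longrightarrow>
        0 \<le> integral {\<theta> + a * e..\<theta> + b * e} (\<lambda>t. f t (t - (\<theta> + a * e)))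
          + integral {\<theta> + b * e..\<theta> + c * e} (\<lambda>t. g t (t - (\<theta> + c * e)))"
  shows "0 \<le> (b\<^sup>2 - a\<^sup>2) * A + (b - a)\<^sup>2 * B + (c\<^sup>2 - b\<^sup>2) * A' - (c - b)\<^sup>2 * B'"
proof -
  define K where "K = ((b\<^sup>2 - a\<^sup>2) * A + (b - a)\<^sup>2 * B + (c\<^sup>2 - b\<^sup>2) * A' - (c - b)\<^sup>2 * B') / 2"
  \<comment> \<open>On the window of size \<open>e\<close>, both the distance from \<theta> and that
    from an end of the window are at most \<open>(\<bar>a\<bar> + \<bar>c\<bar>) * e\<close>;
    \<open>M * e\<close> bounds their sum.\<close>
  define M where "M = 2 * (\<bar>a\<bar> + \<bar>c\<bar>)"
  have M: "0 < M" using ab bc by (auto simp: M_def)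
  have "0 \<le> K + \<epsilon>" if "0 < \<epsilon>" for \<epsilon>
  proof -
    \<comment> \<open>The linearization error is at most \<open>k * (M * e)\<close> on a window of
      length \<open>(c - a) * e\<close>; this choice makes its integral at most
      \<open>\<epsilon> * e\<^sup>2\<close>.\<close>
    define k where "k = \<epsilon> / (M * (c - a))"
    have k: "0 < k" using that M ab bc by (simp add: k_def)
    obtain \<rho> where \<rho>: "0 < \<rho>"
      "\<And>t r. t \<in> S \<Longrightarrow> \<bar>t - \<theta>\<bar> + \<bar>r\<bar> < \<rho> \<Longrightarrow> f t r \<le> (t - \<theta>) * A + r * B + k * (\<bar>t - \<theta>\<bar> + \<bar>r\<bar>)"
      using has_derivative_origin_bound[OF f k] by metis
    obtain \<rho>' where \<rho>': "0 < \<rho>'"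
      "\<And>t r. t \<in> S \<Longrightarrow> \<bar>t - \<theta>\<bar> + \<bar>r\<bar> < \<rho>' \<Longrightarrow> g t r \<le> (t - \<theta>) * A' + r * B' + k * (\<bar>t - \<theta>\<bar> + \<bar>r\<bar>)"
      using has_derivative_origin_bound[OF g k] by metis
    \<comment> \<open>Half of \<open>emax\<close> keeps \<open>e\<close> strictly below it; the
      other term gives \<open>M * e \<le> min \<rho> \<rho>' / 2\<close>, strictly inside both
      radii.\<close>
    define e where "e = min (emax / 2) (min \<rho> \<rho>' / (2 * M))"
    have e: "0 < e" "e < emax" using emax \<rho>(1) \<rho>'(1) M by (auto simp: e_def)
    have "e * M \<le> min \<rho> \<rho>' / (2 * M) * M"
      using M by (intro mult_right_mono) (auto simp: e_def)
    also have "\<dots> = min \<rho> \<rho>' / 2" using M by simp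
    finally have eM: "M * e < \<rho>" "M * e < \<rho>'" using \<rho>(1) \<rho>'(1) by (auto simp: mult.commute)
    let ?p = "\<theta> + a * e" and ?m = "\<theta> + b * e" and ?q = "\<theta> + c * e"
    have ord: "?p \<le> ?m" "?m \<le> ?q" using ab bc e by auto
    have small: "\<bar>t - \<theta>\<bar> + \<bar>t - s\<bar> \<le> M * e"
      if "t \<in> {?p..?q}" "s = ?p \<or> s = ?q" for t s
    proof -
      have "- (\<bar>a\<bar> * e) \<le> a * e" "c * e \<le> \<bar>c\<bar> * e" "0 \<le> \<bar>a\<bar> * e" "0 \<le> \<bar>c\<bar> * e"
        using e(1) by (auto simp: abs_if)
      moreover have "M * e = 2 * (\<bar>a\<bar> * e) + 2 * (\<bar>c\<bar> * e)" by (simp add: M_def algebra_simps)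
      moreover have "a * e \<le> \<bar>a\<bar> * e" "- (\<bar>c\<bar> * e) \<le> c * e" using e(1) by (auto simp: abs_if)
      ultimately show ?thesis using that by (auto simp: abs_if split: if_splits)
    qed
    have "integral {?p..?m} (\<lambda>t. f t (t - ?p)) \<le>
      ((?m - \<theta>)\<^sup>2 - (?p - \<theta>)\<^sup>2) / 2 * A + ((?m - ?p)\<^sup>2 - (?p - ?p)\<^sup>2) / 2 * B + k * (M * e) * (?m - ?p)"
    proof (rule integral_le_affine[OF cf[OF e] ord(1)])
      fix t assume "t \<in> {?p..?m}"
      then have t: "t \<in> {?p..?q}" using ord by auto
      have "f t (t - ?p) \<le> (t - \<theta>) * A + (t - ?p) * B + k * (\<bar>t - \<theta>\<bar> + \<bar>t - ?p\<bar>)"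
        using t small[OF t, of ?p] eM S[OF e] by (intro \<rho>(2)) auto
      also have "\<dots> \<le> (t - \<theta>) * A + (t - ?p) * B + k * (M * e)"
        using small[OF t, of ?p] k by (intro add_left_mono mult_left_mono) auto
      finally show "f t (t - ?p) \<le> (t - \<theta>) * A + (t - ?p) * B + k * (M * e)" .
    qed
    moreover have "integral {?m..?q} (\<lambda>t. g t (t - ?q)) \<le>
      ((?q - \<theta>)\<^sup>2 - (?m - \<theta>)\<^sup>2) / 2 * A' + ((?q - ?q)\<^sup>2 - (?m - ?q)\<^sup>2) / 2 * B' + k * (M * e) * (?q - ?m)"
    proof (rule integral_le_affine[OF cg[OF e] ord(2)])
      fix t assume "t \<in> {?m..?q}"
      then have t: "t \<in> {?p..?q}" using ord by auto
      have "g t (t - ?q) \<le> (t - \<theta>) * A' + (t - ?q) * B' + k * (\<bar>t - \<theta>\<bar> + \<bar>t - ?q\<bar>)"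
        using t small[OF t, of ?q] eM S[OF e] by (intro \<rho>'(2)) auto
      also have "\<dots> \<le> (t - \<theta>) * A' + (t - ?q) * B' + k * (M * e)"
        using small[OF t, of ?q] k by (intro add_left_mono mult_left_mono) auto
      finally show "g t (t - ?q) \<le> (t - \<theta>) * A' + (t - ?q) * B' + k * (M * e)" .
    qed
    ultimately have "0 \<le> ((?m - \<theta>)\<^sup>2 - (?p - \<theta>)\<^sup>2) / 2 * A + ((?m - ?p)\<^sup>2 - (?p - ?p)\<^sup>2) / 2 * B + k * (M * e) * (?m - ?p)
      + (((?q - \<theta>)\<^sup>2 - (?m - \<theta>)\<^sup>2) / 2 * A' + ((?q - ?q)\<^sup>2 - (?m - ?q)\<^sup>2) / 2 * B' + k * (M * e) * (?q - ?m))"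
      using nonneg[OF e] by linarith
    also have "\<dots> = e\<^sup>2 * (K + k * (M * (c - a)))"
      unfolding K_def by (simp add: power2_eq_square field_simps)
    also have "k * (M * (c - a)) = \<epsilon>"
      using M ab bc by (simp add: k_def)
    finally show ?thesis using e(1) by (simp add: zero_le_mult_iff)
  qed
  then have "0 \<le> K" using field_le_epsilon by blast
  then show ?thesis by (simp add: K_def)
qed

text \<open>\<open>f\<close> need not be differentiable, so this is not an instance of the product rule.\<close>

lemma has_derivative_snd_mult_continuous:
  fixes f :: "real \<Rightarrow> real"
  assumes "continuous (at \<theta> within S) f"
  shows "((\<lambda>(t, r). r * f t) has_derivative (\<lambda>(s, r). r * f \<theta>)) (at (\<theta>, 0::real) within S \<times> UNIV)"
  unfolding has_derivative_within_alt
proof (intro conjI allI impI)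
  show "bounded_linear (\<lambda>(s::real, r). r * f \<theta>)"
    unfolding split_beta by (intro bounded_linear_mult_const bounded_linear_snd)
next
  fix e :: real assume "0 < e"
  then obtain \<rho> where \<rho>: "0 < \<rho>" "\<And>t. t \<in> S \<Longrightarrow> dist t \<theta> < \<rho> \<Longrightarrow> dist (f t) (f \<theta>) < e"
    using assms unfolding continuous_within_eps_delta by blast
  have "norm (r * f t - r * f \<theta>) \<le> e * norm ((t, r) - (\<theta>, 0))"
    if "t \<in> S" "norm ((t, r) - (\<theta>, 0)) < \<rho>" for t r
  proof -
    have "dist t \<theta> < \<rho>"
      using norm_fst_le[of "t - \<theta>" r] that(2) by (simp add: dist_norm)
    then have "\<bar>f t - f \<theta>\<bar> \<le> e" using \<rho>(2)[OF that(1)] by (simp add: dist_norm less_imp_le)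
    moreover have "\<bar>r\<bar> \<le> norm ((t, r) - (\<theta>, 0))"
      using norm_snd_le[of r "t - \<theta>"] by simp
    ultimately have "\<bar>f t - f \<theta>\<bar> * \<bar>r\<bar> \<le> e * norm ((t, r) - (\<theta>, 0))"
      using \<open>0 < e\<close> by (intro mult_mono) auto
    then show ?thesis by (simp add: abs_mult mult.commute flip: right_diff_distrib)
  qed
  then show "\<exists>d>0. \<forall>y\<in>S \<times> UNIV. norm (y - (\<theta>, 0)) < d \<longrightarrow>
      norm ((case y of (t, r) \<Rightarrow> r * f t) - (case (\<theta>, 0) of (t, r) \<Rightarrow> r * f t)
        - (case y - (\<theta>, 0) of (s, r) \<Rightarrow> r * f \<theta>)) \<le> e * norm (y - (\<theta>, 0))"
    using \<rho>(1) by (intro exI[of _ \<rho>]) auto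
qed

context C1_lagrangian
begin

text \<open>Splits the excess into its value at \<open>r = 0\<close>, the change of \<open>L\<close>
  under the shift of position by \<open>r\<close> times \<open>z\<close>, and the term with
  \<open>L_x\<close>. As \<open>L_x\<close> is merely continuous, the last one is covered by
  \<open>has_derivative_snd_mult_continuous\<close>.\<close>

lemma excess_has_derivative:
  fixes x u :: "real \<Rightarrow> real ^ 'n"
  assumes \<theta>: "\<theta> \<in> T"
    and x: "(x has_vector_derivative x') (at \<theta> within S)"
    and u: "(u has_vector_derivative u') (at \<theta> within S)"
    and A: "((\<lambda>t. excess L x u t 0 z) has_real_derivative A) (at \<theta> within S)"
  shows "((\<lambda>(t, r). excess L x u t r z) has_derivative
     (\<lambda>(s, r). s * A + r * ((L_x L \<theta> (x \<theta>) (u \<theta> + z) - L_x L \<theta> (x \<theta>) (u \<theta>)) \<bullet> z)))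
     (at (\<theta>, 0) within S \<times> UNIV)"
proof -
  let ?F = "at (\<theta>, 0::real) within S \<times> UNIV"
  have lift: "((\<lambda>y. f (fst y)) has_derivative (\<lambda>h. f' (fst h))) ?F"
    if "(f has_derivative f') (at \<theta> within S)" for f :: "real \<Rightarrow> 'a::real_normed_vector" and f'
  proof -
    have "((fst :: real \<times> real \<Rightarrow> real) has_derivative fst) ?F"
      by (auto intro!: derivative_eq_intros)
    then show ?thesis
      by (rule has_derivative_in_compose) (rule has_derivative_subset[of f f' _ S], use that in auto)
  qed
  have f: "((\<lambda>y. fst y) has_derivative fst) ?F" "((\<lambda>y. snd y) has_derivative snd) ?F"
    by (auto intro!: derivative_eq_intros)
  have x': "((\<lambda>y. x (fst y)) has_derivative (\<lambda>h. fst h *\<^sub>R x')) ?F"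
    and u': "((\<lambda>y. u (fst y)) has_derivative (\<lambda>h. fst h *\<^sub>R u')) ?F"
    and A': "((\<lambda>y. excess L x u (fst y) 0 z) has_derivative (\<lambda>h. A * fst h)) ?F"
    using lift x u A unfolding has_vector_derivative_def has_field_derivative_def by auto
  have "continuous (at \<theta> within S) (\<lambda>t. L_x L t (x t) (u t) \<bullet> z)"
    using has_vector_derivative_continuous[OF x] has_vector_derivative_continuous[OF u] \<theta>
    unfolding continuous_within by (intro tendsto_intros tendsto_L_x_comp)
  from has_derivative_snd_mult_continuous[OF this]
  have m: "((\<lambda>y. snd y * (L_x L (fst y) (x (fst y)) (u (fst y)) \<bullet> z)) has_derivative
      (\<lambda>h. snd h * (L_x L \<theta> (x \<theta>) (u \<theta>) \<bullet> z))) ?F"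
    by (simp add: split_beta')
  have xr: "((\<lambda>y. x (fst y) + snd y *\<^sub>R z) has_derivative (\<lambda>h. fst h *\<^sub>R x' + snd h *\<^sub>R z)) ?F"
    by (intro has_derivative_add x' has_derivative_scaleR_left f)
  have uz: "((\<lambda>y. u (fst y) + z) has_derivative (\<lambda>h. fst h *\<^sub>R u')) ?F"
    using has_derivative_add[OF u' has_derivative_const] by simp
  have \<theta>': "fst (\<theta>, 0::real) \<in> T" using \<theta> by simp
  let ?d = "blinfun_apply (dL (\<theta>, x \<theta>, u \<theta> + z))"
  have L1: "((\<lambda>y. L (fst y) (x (fst y) + snd y *\<^sub>R z) (u (fst y) + z)) has_derivative
      (\<lambda>h. ?d (fst h, fst h *\<^sub>R x' + snd h *\<^sub>R z, fst h *\<^sub>R u'))) ?F"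
    using has_derivative_L_comp[OF \<theta>' f(1) xr uz] by simp
  have L2: "((\<lambda>y. L (fst y) (x (fst y)) (u (fst y) + z)) has_derivative
      (\<lambda>h. ?d (fst h, fst h *\<^sub>R x', fst h *\<^sub>R u'))) ?F"
    using has_derivative_L_comp[OF \<theta>' f(1) x' uz] by simp
  \<comment> \<open>At \<open>r = 0\<close> shifted and unshifted arguments coincide, so both
    derivatives are values of the same linear map; the contributions of time, \<open>x'\<close> and
    \<open>u'\<close> cancel and the position shift along \<open>z\<close> remains.\<close>
  have diff: "?d (fst h, fst h *\<^sub>R x' + snd h *\<^sub>R z, fst h *\<^sub>R u') - ?d (fst h, fst h *\<^sub>R x', fst h *\<^sub>R u')
      = snd h * (L_x L \<theta> (x \<theta>) (u \<theta> + z) \<bullet> z)" for h :: "real \<times> real"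
    by (simp add: blinfun.diff_right[symmetric] dL_x[OF \<theta>])
  have "((\<lambda>y. excess L x u (fst y) 0 z
        + (L (fst y) (x (fst y) + snd y *\<^sub>R z) (u (fst y) + z) - L (fst y) (x (fst y)) (u (fst y) + z))
        - snd y * (L_x L (fst y) (x (fst y)) (u (fst y)) \<bullet> z)) has_derivative
      (\<lambda>h. A * fst h + (?d (fst h, fst h *\<^sub>R x' + snd h *\<^sub>R z, fst h *\<^sub>R u')
         - ?d (fst h, fst h *\<^sub>R x', fst h *\<^sub>R u')) - snd h * (L_x L \<theta> (x \<theta>) (u \<theta>) \<bullet> z))) ?F"
    by (intro has_derivative_add has_derivative_diff A' L1 L2 m)
  moreover have "(\<lambda>y. excess L x u (fst y) 0 z
        + (L (fst y) (x (fst y) + snd y *\<^sub>R z) (u (fst y) + z) - L (fst y) (x (fst y)) (u (fst y) + z))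
        - snd y * (L_x L (fst y) (x (fst y)) (u (fst y)) \<bullet> z)) = (\<lambda>(t, r). excess L x u t r z)"
    by (auto simp: excess_def fun_eq_iff)
  moreover have "(\<lambda>h. A * fst h + (?d (fst h, fst h *\<^sub>R x' + snd h *\<^sub>R z, fst h *\<^sub>R u')
         - ?d (fst h, fst h *\<^sub>R x', fst h *\<^sub>R u')) - snd h * (L_x L \<theta> (x \<theta>) (u \<theta>) \<bullet> z))
      = (\<lambda>(s, r). s * A + r * ((L_x L \<theta> (x \<theta>) (u \<theta> + z) - L_x L \<theta> (x \<theta>) (u \<theta>)) \<bullet> z))"
    unfolding diff by (auto simp: fun_eq_iff algebra_simps)
  ultimately show ?thesis by simp
qed

text \<open>The inner product of \<open>L_v\<close> with \<open>z\<close> is where differentiability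
  of \<open>L_v\<close> enters: it is composed with the curve, whose velocity \<open>u\<close> is
  differentiable at \<theta>.\<close>

lemma excess_0_has_derivative:
  fixes x u :: "real \<Rightarrow> real ^ 'n"
  assumes \<theta>: "\<theta> \<in> T"
    and Lv: "(\<lambda>(t, x, v). L_v L t x v) differentiable (at (\<theta>, x \<theta>, u \<theta>))"
    and x: "(x has_vector_derivative x') (at \<theta> within S)"
    and u: "(u has_vector_derivative u') (at \<theta> within S)"
  obtains A where "((\<lambda>t. excess L x u t 0 z) has_real_derivative A) (at \<theta> within S)"
proof -
  have id: "((\<lambda>t. t) has_derivative (\<lambda>h. h)) (at \<theta> within S)" by (rule has_derivative_ident)
  have x': "(x has_derivative (\<lambda>h. h *\<^sub>R x')) (at \<theta> within S)"
    and u': "(u has_derivative (\<lambda>h. h *\<^sub>R u')) (at \<theta> within S)"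
    using x u by (auto simp: has_vector_derivative_def)
  have uz: "((\<lambda>t. u t + z) has_derivative (\<lambda>h. h *\<^sub>R u')) (at \<theta> within S)"
    using u' by (auto intro!: derivative_eq_intros)
  obtain d where "((\<lambda>(t, x, v). L_v L t x v) has_derivative d) (at (\<theta>, x \<theta>, u \<theta>))"
    using Lv unfolding differentiable_def by blast
  from has_derivative_compose[OF has_derivative_Pair[OF id has_derivative_Pair[OF x' u']] this]
  have "(\<lambda>t. L_v L t (x t) (u t) \<bullet> z) differentiable (at \<theta> within S)"
    unfolding differentiable_def by (auto intro: has_derivative_inner_left)
  moreover have "(\<lambda>t. L t (x t) (u t + z)) differentiable (at \<theta> within S)"
    "(\<lambda>t. L t (x t) (u t)) differentiable (at \<theta> within S)"
    using has_derivative_L_comp[OF \<theta> id x' uz] has_derivative_L_comp[OF \<theta> id x' u']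
    unfolding differentiable_def by blast+
  ultimately have "(\<lambda>t. excess L x u t 0 z) differentiable (at \<theta> within S)"
    unfolding excess_def by (simp add: differentiable_diff)
  then show thesis
    using that by (metis real_differentiable_def)
qed

end

context weak_minimum
begin

text \<open>Covers both sides: \<open>a = 0\<close> puts the hat to the right of \<theta>,
  \<open>c = 0\<close> to the left. With \<open>c - a = 1\<close> and \<open>emax \<le> 1\<close>
  its support has length at most 1, as \<open>excess_integral_nonneg\<close> demands.\<close>

lemma second_order_condition:
  fixes u :: "real \<Rightarrow> real ^ 'n"
  assumes \<theta>: "\<theta> \<in> S" and S: "S \<subseteq> {t0..t1}" and u: "continuous_on S u"
    and abc: "a < b" "b < c" "c - a = 1" and yz: "(b - a) *\<^sub>R y + (c - b) *\<^sub>R z = 0"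
      "norm y \<le> d" "norm z \<le> d"
    and emax: "0 < emax" "emax \<le> 1"
    and e: "\<And>e. 0 < e \<Longrightarrow> e < emax \<Longrightarrow> {\<theta> + a * e..\<theta> + c * e} \<subseteq> S"
      "\<And>e t. 0 < e \<Longrightarrow> e < emax \<Longrightarrow> t \<in> {\<theta> + a * e<..<\<theta> + c * e} \<Longrightarrow> (x has_vector_derivative u t) (at t)"
    and x': "(x has_vector_derivative x') (at \<theta> within S)"
    and u': "(u has_vector_derivative u') (at \<theta> within S)"
    and A: "((\<lambda>t. excess L x u t 0 y) has_real_derivative A) (at \<theta> within S)" "excess L x u \<theta> 0 y = 0"
    and A': "((\<lambda>t. excess L x u t 0 z) has_real_derivative A') (at \<theta> within S)" "excess L x u \<theta> 0 z = 0"
  shows "0 \<le> (b\<^sup>2 - a\<^sup>2) * A + (b - a)\<^sup>2 * ((L_x L \<theta> (x \<theta>) (u \<theta> + y) - L_x L \<theta> (x \<theta>) (u \<theta>)) \<bullet> y)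
     + (c\<^sup>2 - b\<^sup>2) * A' - (c - b)\<^sup>2 * ((L_x L \<theta> (x \<theta>) (u \<theta> + z) - L_x L \<theta> (x \<theta>) (u \<theta>)) \<bullet> z)"
proof (rule two_piece_second_order[OF abc(1,2) emax(1) excess_has_derivative[OF _ x' u' A(1)] A(2)
      excess_has_derivative[OF _ x' u' A'(1)] A'(2)])
  show "\<theta> \<in> T" "\<theta> \<in> T" using \<theta> S I by auto
  fix \<epsilon> assume \<epsilon>: "0 < \<epsilon>" "\<epsilon> < emax"
  let ?p = "\<theta> + a * \<epsilon>" and ?m = "\<theta> + b * \<epsilon>" and ?q = "\<theta> + c * \<epsilon>"
  show "{?p..?q} \<subseteq> S" by (rule e(1)[OF \<epsilon>])
  have ord: "?p < ?m" "?m < ?q" using abc \<epsilon> by auto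
  have sub: "{?p..?m} \<subseteq> {?p..?q}" "{?m..?q} \<subseteq> {?p..?q}" "{?p..?q} \<subseteq> S" "{?p..?q} \<subseteq> {t0..t1}" "{?p..?q} \<subseteq> T"
    using ord order_trans[OF e(1)[OF \<epsilon>] S] order_trans[OF order_trans[OF e(1)[OF \<epsilon>] S] I]
    by (auto intro: e(1)[OF \<epsilon>] del: subsetI)
  show "continuous_on {?p..?m} (\<lambda>t. excess L x u t (t - ?p) y)"
    by (intro continuous_on_excess continuous_on_subset[OF u] continuous_on_subset[OF continuous_on_x])
      (use sub in auto)
  show "continuous_on {?m..?q} (\<lambda>t. excess L x u t (t - ?q) z)"
    by (intro continuous_on_excess continuous_on_subset[OF u] continuous_on_subset[OF continuous_on_x])
      (use sub in auto)
  show "0 \<le> integral {?p..?m} (\<lambda>t. excess L x u t (t - ?p) y) + integral {?m..?q} (\<lambda>t. excess L x u t (t - ?q) z)"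
  proof (rule excess_integral_nonneg[OF _ _ _ _ yz(2,3)])
    show "t0 \<le> ?p" "?q \<le> t1" using sub(4) ord by auto
    have "?q - ?p = (c - a) * \<epsilon>" by (simp add: algebra_simps)
    then show "?q - ?p \<le> 1" using abc(3) \<epsilon> emax by simp
    have "(?m - ?p) *\<^sub>R y + (?q - ?m) *\<^sub>R z = \<epsilon> *\<^sub>R ((b - a) *\<^sub>R y + (c - b) *\<^sub>R z)"
      by (simp add: algebra_simps)
    then show "hat_data ?p ?m ?q y z" using ord yz(1) by unfold_locales simp_all
    show "continuous_on {?p..?q} u" by (rule continuous_on_subset[OF u sub(3)])
  qed (use e(2)[OF \<epsilon>] in auto)
qed

end

section \<open>Necessary conditions\<close>

context weak_minimum
begin

text \<open>The choice \<open>(a, b, c) = (0, lam, 1)\<close>. Expressing \<xi> by \<eta> turns the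
  factor \<open>(1 - lam)\<^sup>2\<close> of the inner product with \<xi> into
  \<open>- lam * (1 - lam)\<close> for the one with \<eta>; this completes \<open>lam\<close> times
  the expression \<open>M1\<close>.\<close>

lemma second_order_condition_right:
  fixes u :: "real \<Rightarrow> real ^ 'n"
  assumes \<beta>: "0 < \<beta>" and S: "{\<theta>..\<theta> + \<beta>} \<subseteq> {t0..t1}" and u: "continuous_on {\<theta>..\<theta> + \<beta>} u"
    and deriv: "\<And>t. t \<in> {\<theta><..<\<theta> + \<beta>} \<Longrightarrow> (x has_vector_derivative u t) (at t)"
    and x': "(x has_vector_derivative x') (at \<theta> within {\<theta>..\<theta> + \<beta>})"
    and u': "(u has_vector_derivative u') (at \<theta> within {\<theta>..\<theta> + \<beta>})"
    and lam: "lam \<in> {0<..<1}" and \<xi>: "\<xi> = (lam / (lam - 1)) *\<^sub>R \<eta>" and norm: "norm \<eta> \<le> d" "norm \<xi> \<le> d"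
    and A: "((\<lambda>t. excess L x u t 0 \<eta>) has_real_derivative A) (at \<theta> within {\<theta>..\<theta> + \<beta>})"
      "excess L x u \<theta> 0 \<eta> = 0"
    and A': "((\<lambda>t. excess L x u t 0 \<xi>) has_real_derivative A') (at \<theta> within {\<theta>..\<theta> + \<beta>})"
      "excess L x u \<theta> 0 \<xi> = 0"
  shows "0 \<le> lam * (lam * ((L_x L \<theta> (x \<theta>) (u \<theta> + \<eta>) - L_x L \<theta> (x \<theta>) (u \<theta>)) \<bullet> \<eta>)
      + (1 - lam) * ((L_x L \<theta> (x \<theta>) (u \<theta> + \<xi>) - L_x L \<theta> (x \<theta>) (u \<theta>)) \<bullet> \<eta>))
      + (lam\<^sup>2 * A + (1 - lam\<^sup>2) * A')"
proof -
  let ?B = "(L_x L \<theta> (x \<theta>) (u \<theta> + \<eta>) - L_x L \<theta> (x \<theta>) (u \<theta>)) \<bullet> \<eta>"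
  let ?D = "L_x L \<theta> (x \<theta>) (u \<theta> + \<xi>) - L_x L \<theta> (x \<theta>) (u \<theta>)"
  have "0 \<le> (lam\<^sup>2 - 0\<^sup>2) * A + (lam - 0)\<^sup>2 * ?B + (1\<^sup>2 - lam\<^sup>2) * A' - (1 - lam)\<^sup>2 * (?D \<bullet> \<xi>)"
  proof (rule second_order_condition[OF _ S u, where emax = "min 1 \<beta>"])
    show "(lam - 0) *\<^sub>R \<eta> + (1 - lam) *\<^sub>R \<xi> = 0"
      using lam unfolding \<xi> by (simp add: field_simps flip: scaleR_left.add)
    show "(x has_vector_derivative u t) (at t)"
      if "0 < e" "e < min 1 \<beta>" "t \<in> {\<theta> + 0 * e<..<\<theta> + 1 * e}" for e t
      using that by (intro deriv) auto
  qed (use lam \<beta> norm x' u' A A' in auto)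
  moreover have "(1 - lam)\<^sup>2 * (?D \<bullet> \<xi>) = - (lam * (1 - lam) * (?D \<bullet> \<eta>))"
  proof -
    have "(1 - lam)\<^sup>2 * (?D \<bullet> \<xi>) = (1 - lam)\<^sup>2 * (lam / (lam - 1)) * (?D \<bullet> \<eta>)"
      by (subst (2) \<xi>) (simp only: inner_scaleR_right mult.assoc)
    also have "(1 - lam)\<^sup>2 * (lam / (lam - 1)) = - (lam * (1 - lam))"
      using lam by (simp add: field_simps power2_eq_square)
    finally show ?thesis by simp
  qed
  ultimately show ?thesis by (simp add: algebra_simps power2_eq_square)
qed

text \<open>The choice \<open>(a, b, c) = (- 1, - lam, 0)\<close> with the slopes interchanged. All
  four coefficients become the negatives of those on the right, hence the reversed
  inequality.\<close>

lemma second_order_condition_left: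
  fixes u :: "real \<Rightarrow> real ^ 'n"
  assumes \<beta>: "0 < \<beta>" and S: "{\<theta> - \<beta>..\<theta>} \<subseteq> {t0..t1}" and u: "continuous_on {\<theta> - \<beta>..\<theta>} u"
    and deriv: "\<And>t. t \<in> {\<theta> - \<beta><..<\<theta>} \<Longrightarrow> (x has_vector_derivative u t) (at t)"
    and x': "(x has_vector_derivative x') (at \<theta> within {\<theta> - \<beta>..\<theta>})"
    and u': "(u has_vector_derivative u') (at \<theta> within {\<theta> - \<beta>..\<theta>})"
    and lam: "lam \<in> {0<..<1}" and \<xi>: "\<xi> = (lam / (lam - 1)) *\<^sub>R \<eta>" and norm: "norm \<eta> \<le> d" "norm \<xi> \<le> d"
    and A: "((\<lambda>t. excess L x u t 0 \<eta>) has_real_derivative A) (at \<theta> within {\<theta> - \<beta>..\<theta>})"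
      "excess L x u \<theta> 0 \<eta> = 0"
    and A': "((\<lambda>t. excess L x u t 0 \<xi>) has_real_derivative A') (at \<theta> within {\<theta> - \<beta>..\<theta>})"
      "excess L x u \<theta> 0 \<xi> = 0"
  shows "lam * (lam * ((L_x L \<theta> (x \<theta>) (u \<theta> + \<eta>) - L_x L \<theta> (x \<theta>) (u \<theta>)) \<bullet> \<eta>)
      + (1 - lam) * ((L_x L \<theta> (x \<theta>) (u \<theta> + \<xi>) - L_x L \<theta> (x \<theta>) (u \<theta>)) \<bullet> \<eta>))
      + (lam\<^sup>2 * A + (1 - lam\<^sup>2) * A') \<le> 0"
proof -
  let ?B = "(L_x L \<theta> (x \<theta>) (u \<theta> + \<eta>) - L_x L \<theta> (x \<theta>) (u \<theta>)) \<bullet> \<eta>"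
  let ?D = "L_x L \<theta> (x \<theta>) (u \<theta> + \<xi>) - L_x L \<theta> (x \<theta>) (u \<theta>)"
  have "0 \<le> ((- lam)\<^sup>2 - (- 1)\<^sup>2) * A' + (- lam - - 1)\<^sup>2 * (?D \<bullet> \<xi>) + (0\<^sup>2 - (- lam)\<^sup>2) * A - (0 - - lam)\<^sup>2 * ?B"
  proof (rule second_order_condition[OF _ S u, where emax = "min 1 \<beta>"])
    show "(- lam - - 1) *\<^sub>R \<xi> + (0 - - lam) *\<^sub>R \<eta> = 0"
      using lam unfolding \<xi> by (simp add: field_simps flip: scaleR_left.add)
    show "(x has_vector_derivative u t) (at t)"
      if "0 < e" "e < min 1 \<beta>" "t \<in> {\<theta> + - 1 * e<..<\<theta> + 0 * e}" for e t
      using that by (intro deriv) auto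
  qed (use lam \<beta> norm x' u' A A' in auto)
  moreover have "(1 - lam)\<^sup>2 * (?D \<bullet> \<xi>) = - (lam * (1 - lam) * (?D \<bullet> \<eta>))"
  proof -
    have "(1 - lam)\<^sup>2 * (?D \<bullet> \<xi>) = (1 - lam)\<^sup>2 * (lam / (lam - 1)) * (?D \<bullet> \<eta>)"
      by (subst (2) \<xi>) (simp only: inner_scaleR_right mult.assoc)
    also have "(1 - lam)\<^sup>2 * (lam / (lam - 1)) = - (lam * (1 - lam))"
      using lam by (simp add: field_simps power2_eq_square)
    finally show ?thesis by simp
  qed
  ultimately show ?thesis by (simp add: algebra_simps power2_eq_square)
qed

text \<open>Weierstrass condition for a weak minimum: the hat with slopes \<open>y\<close> and \<open>- s y\<close> gives
  \<open>s E(y) + E(- s y) \<ge> 0\<close>, and \<open>E(- s y) = o(s)\<close> as \<open>s\<close> tends to \<open>0\<close>.\<close>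

lemma weierstrass_condition:
  fixes u :: "real \<Rightarrow> real ^ 'n"
  assumes \<beta>: "0 < \<beta>" and S: "{\<theta>..\<theta> + \<beta>} \<subseteq> {t0..t1}" and u: "continuous_on {\<theta>..\<theta> + \<beta>} u"
    and deriv: "\<And>t. t \<in> {\<theta><..<\<theta> + \<beta>} \<Longrightarrow> (x has_vector_derivative u t) (at t)"
    and y: "norm y \<le> d"
  shows "0 \<le> excess L x u \<theta> 0 y"
proof -
  let ?S = "{\<theta>..\<theta> + \<beta>}"
  have ST: "?S \<subseteq> T" using S I by blast
  have \<theta>: "\<theta> \<in> ?S" "\<theta> \<in> T" using \<beta> ST by auto
  \<comment> \<open>Continuity of the excess at \<open>(\<theta>, 0)\<close>: on a small hat each
    leg contributes at most its length times the value at \<theta> enlarged by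
    \<open>k\<close>.\<close>
  have near: "\<exists>\<rho>>0. \<forall>t\<in>?S. \<forall>r. \<bar>t - \<theta>\<bar> + \<bar>r\<bar> < \<rho> \<longrightarrow> excess L x u t r z \<le> excess L x u \<theta> 0 z + k"
    if "0 < k" for z and k :: real
  proof -
    have "continuous_on (?S \<times> UNIV) (\<lambda>w::real \<times> real. x (fst w))" "continuous_on (?S \<times> UNIV) (\<lambda>w::real \<times> real. u (fst w))"
      using S by (auto intro!: continuous_on_compose2[OF continuous_on_x] continuous_on_compose2[OF u] continuous_intros)
    then have "continuous_on (?S \<times> UNIV) (\<lambda>w. excess L x u (fst w) (snd w) z)"
      unfolding excess_def using ST by (intro continuous_intros) auto
    then obtain \<rho> where \<rho>: "0 < \<rho>" "\<And>w. w \<in> ?S \<times> UNIV \<Longrightarrow> dist w (\<theta>, 0) < \<rho> \<Longrightarrow>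
        dist (excess L x u (fst w) (snd w) z) (excess L x u \<theta> 0 z) < k"
      using \<theta>(1) \<open>0 < k\<close> unfolding continuous_on_iff by (metis UNIV_I SigmaI fst_conv snd_conv)
    have "excess L x u t r z \<le> excess L x u \<theta> 0 z + k" if "t \<in> ?S" "\<bar>t - \<theta>\<bar> + \<bar>r\<bar> < \<rho>" for t r
    proof -
      have "dist (t, r) (\<theta>, 0) \<le> \<bar>t - \<theta>\<bar> + \<bar>r\<bar>"
        using norm_Pair_le[of "t - \<theta>" r] by (simp add: dist_norm)
      then show ?thesis using \<rho>(2)[of "(t, r)"] that by (auto simp: dist_real_def)
    qed
    then show ?thesis using \<rho>(1) by blast
  qed
  have two: "0 \<le> s * excess L x u \<theta> 0 y + excess L x u \<theta> 0 (- s *\<^sub>R y)" if s: "0 < s" "s \<le> 1" for s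
  proof (rule field_le_epsilon)
    fix \<epsilon> :: real assume "0 < \<epsilon>"
    define k where "k = \<epsilon> / (1 + s)"
    have k: "0 < k" using \<open>0 < \<epsilon>\<close> s by (simp add: k_def)
    let ?z = "- s *\<^sub>R y"
    obtain \<rho> where \<rho>: "0 < \<rho>" "\<forall>t\<in>?S. \<forall>r. \<bar>t - \<theta>\<bar> + \<bar>r\<bar> < \<rho> \<longrightarrow> excess L x u t r y \<le> excess L x u \<theta> 0 y + k"
      using near[OF k] by metis
    obtain \<rho>' where \<rho>': "0 < \<rho>'" "\<forall>t\<in>?S. \<forall>r. \<bar>t - \<theta>\<bar> + \<bar>r\<bar> < \<rho>' \<longrightarrow> excess L x u t r ?z \<le> excess L x u \<theta> 0 ?z + k"
      using near[OF k] by metis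
    \<comment> \<open>The support has length \<open>(1 + s) * e \<le> 2 * e\<close>, so it is at
      most 1 long and fits into \<open>?S\<close>; on it the distance from \<theta> plus the size of
      \<open>r\<close> is at most \<open>4 * e\<close>, below both radii.\<close>
    define e where "e = min (min 1 \<beta> / 2) (min \<rho> \<rho>' / 8)"
    have e: "0 < e" using \<beta> \<rho>(1) \<rho>'(1) by (simp add: e_def)
    have se: "s * e \<le> e" "0 < s * e" using s e by auto
    have e_le: "2 * e \<le> 1" "2 * e \<le> \<beta>" "8 * e \<le> \<rho>" "8 * e \<le> \<rho>'" by (auto simp: e_def)
    let ?m = "\<theta> + s * e" and ?q = "\<theta> + s * e + e"
    have sub: "{\<theta>..?m} \<subseteq> ?S" "{?m..?q} \<subseteq> ?S" "{\<theta>..?q} \<subseteq> ?S" using se e_le by auto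
    have cont: "continuous_on ?S (\<lambda>t. excess L x u t (t - c) z)" for c z
      by (intro continuous_on_excess ST u continuous_on_subset[OF continuous_on_x S])
    have "0 \<le> integral {\<theta>..?m} (\<lambda>t. excess L x u t (t - \<theta>) y) + integral {?m..?q} (\<lambda>t. excess L x u t (t - ?q) ?z)"
    proof (rule excess_integral_nonneg)
      show "norm ?z \<le> d"
        using mult_mono[OF s(2) y] s by simp
      show "hat_data \<theta> ?m ?q y ?z"
        by unfold_locales (use se e in \<open>auto simp: algebra_simps\<close>)
      show "continuous_on {\<theta>..?q} u" by (rule continuous_on_subset[OF u sub(3)])
      show "t0 \<le> \<theta>" "?q \<le> t1" using subset_trans[OF sub(3) S] se e by auto
    qed (use deriv y se e_le in auto)
    also have "integral {\<theta>..?m} (\<lambda>t. excess L x u t (t - \<theta>) y) \<le> (excess L x u \<theta> 0 y + k) * (?m - \<theta>)"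
    proof (rule integral_le_const[OF continuous_on_subset[OF cont sub(1)]])
      show "excess L x u t (t - \<theta>) y \<le> excess L x u \<theta> 0 y + k" if "t \<in> {\<theta>..?m}" for t
        using that sub(1) se e_le by (intro \<rho>(2)[rule_format]) auto
    qed (use se in auto)
    also have "integral {?m..?q} (\<lambda>t. excess L x u t (t - ?q) ?z) \<le> (excess L x u \<theta> 0 ?z + k) * (?q - ?m)"
    proof (rule integral_le_const[OF continuous_on_subset[OF cont sub(2)]])
      show "excess L x u t (t - ?q) ?z \<le> excess L x u \<theta> 0 ?z + k" if "t \<in> {?m..?q}" for t
        using that sub(2) se e_le by (intro \<rho>'(2)[rule_format]) auto
    qed (use e in auto)
    also have "(excess L x u \<theta> 0 y + k) * (?m - \<theta>) + (excess L x u \<theta> 0 ?z + k) * (?q - ?m)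
        = e * (s * excess L x u \<theta> 0 y + excess L x u \<theta> 0 ?z + k * (1 + s))"
      by (simp add: algebra_simps)
    also have "k * (1 + s) = \<epsilon>" using s by (simp add: k_def)
    finally show "0 \<le> s * excess L x u \<theta> 0 y + excess L x u \<theta> 0 ?z + \<epsilon>"
      using e by (simp add: zero_le_mult_iff)
  qed
  \<comment> \<open>The excess subtracts the linear part in the velocity, so \<phi> and its
    derivative vanish at 0. Dividing \<open>two\<close> by \<open>s\<close> and letting
    \<open>s\<close> decrease to 0 leaves the excess of \<open>y\<close>.\<close>
  define \<phi> where "\<phi> s = excess L x u \<theta> 0 (- s *\<^sub>R y)" for s
  have "((\<lambda>s. L \<theta> (x \<theta>) (u \<theta> + - s *\<^sub>R y)) has_derivative
      (\<lambda>h. dL (\<theta>, x \<theta>, u \<theta> + - 0 *\<^sub>R y) (0, 0, - h *\<^sub>R y))) (at 0)"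
    by (rule has_derivative_L_comp) (use \<theta>(2) in \<open>auto intro!: derivative_eq_intros\<close>)
  then have "((\<lambda>s. L \<theta> (x \<theta>) (u \<theta> + - s *\<^sub>R y)) has_real_derivative - (L_v L \<theta> (x \<theta>) (u \<theta>) \<bullet> y)) (at 0)"
    unfolding has_field_derivative_def by (rule has_derivative_eq_rhs) (auto simp: dL_v[OF \<theta>(2)])
  then have "(\<phi> has_real_derivative 0) (at 0)"
    unfolding \<phi>_def excess_def by (auto intro!: derivative_eq_intros)
  then have "((\<lambda>s. (\<phi> s - \<phi> 0) / (s - 0)) \<longlongrightarrow> 0) (at_right 0)"
    unfolding has_field_derivative_iff by (rule tendsto_within_subset) auto
  then have "((\<lambda>s. excess L x u \<theta> 0 y + \<phi> s / s) \<longlongrightarrow> excess L x u \<theta> 0 y + 0) (at_right 0)"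
    by (intro tendsto_add tendsto_const) (simp add: \<phi>_def excess_def)
  moreover have "eventually (\<lambda>s. 0 \<le> excess L x u \<theta> 0 y + \<phi> s / s) (at_right 0)"
    unfolding eventually_at_right_field
  proof (intro exI[of _ 1] conjI allI impI)
    fix s :: real assume "0 < s" "s < 1"
    then show "0 \<le> excess L x u \<theta> 0 y + \<phi> s / s"
      using two[of s] by (simp add: \<phi>_def field_simps)
  qed simp
  ultimately show ?thesis
    using tendsto_lowerbound[of _ _ "at_right (0::real)" 0] by fastforce
qed

end

section \<open>One-sided values along the extremal\<close>

text \<open>One-sided values and derivatives do not see \<open>F \<theta>\<close>. So
  \<open>F\<close> may be replaced by a function \<open>G\<close> that agrees with it on the chosen
  side and has a derivative at \<theta> within that side.\<close>

lemma one_sided_value_and_derivative: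
  fixes F G :: "real \<Rightarrow> real"
  assumes bot: "at \<theta> within R \<noteq> bot" and ev: "eventually (\<lambda>t. F t = G t) (at \<theta> within R)"
    and G: "(G has_real_derivative D) (at \<theta> within R)"
  shows "Lim (at \<theta> within R) F = G \<theta>"
    and "vector_derivative (F(\<theta> := Lim (at \<theta> within R) F)) (at \<theta> within R) = D"
proof -
  have "(G \<longlongrightarrow> G \<theta>) (at \<theta> within R)"
    using DERIV_continuous[OF G] by (simp add: continuous_within)
  then have "(F \<longlongrightarrow> G \<theta>) (at \<theta> within R)"
    by (rule Lim_transform_eventually) (use ev in eventually_elim, simp)
  then show Lim: "Lim (at \<theta> within R) F = G \<theta>" by (rule tendsto_Lim[OF bot])
  have "(F(\<theta> := G \<theta>) has_vector_derivative D) (at \<theta> within R)"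
  proof (subst has_vector_derivative_cong_ev)
    show "eventually (\<lambda>t. t \<in> R \<longrightarrow> (F(\<theta> := G \<theta>)) t = G t) (nhds \<theta>)"
      using ev unfolding eventually_at_filter by eventually_elim auto
    show "(G has_vector_derivative D) (at \<theta> within R)"
      using G by (simp add: has_real_derivative_iff_has_vector_derivative)
  qed simp
  then show "vector_derivative (F(\<theta> := Lim (at \<theta> within R) F)) (at \<theta> within R) = D"
    unfolding Lim by (rule vector_derivative_within[OF bot])
qed

lemma Ebar_eq_excess:
  assumes "vel I x t = u t"
  shows "Ebar L I x t z = excess L x u t 0 z"
  using assms by (simp add: Ebar_def excess_def)

text \<open>A general \<open>R\<close> serves both sides. For \<open>M1\<close> just a limit is
  claimed, since \<open>L_x\<close> is continuous but possibly not differentiable.\<close>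

lemma (in C1_lagrangian) one_sided_values:
  fixes x u :: "real \<Rightarrow> real ^ 'n"
  assumes \<theta>: "\<theta> \<in> T" and bot: "at \<theta> within R \<noteq> bot"
    and Lv: "(\<lambda>(t, x, v). L_v L t x v) differentiable (at (\<theta>, x \<theta>, u \<theta>))"
    and ev: "eventually (\<lambda>t. vel I x t = u t) (at \<theta> within R)"
    and x': "(x has_vector_derivative x') (at \<theta> within R)"
    and u': "(u has_vector_derivative u') (at \<theta> within R)"
    and \<xi>: "\<xi> = (lam / (lam - 1)) *\<^sub>R \<eta>"
  obtains A A' where "((\<lambda>t. excess L x u t 0 \<eta>) has_real_derivative A) (at \<theta> within R)"
    "((\<lambda>t. excess L x u t 0 \<xi>) has_real_derivative A') (at \<theta> within R)"
    "Lim (at \<theta> within R) (\<lambda>t. Ebar L I x t \<eta>) = excess L x u \<theta> 0 \<eta>"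
    "Lim (at \<theta> within R) (\<lambda>t. Ebar L I x t \<xi>) = excess L x u \<theta> 0 \<xi>"
    "Lim (at \<theta> within R) (\<lambda>t. M1 L I x t lam \<eta>) =
      lam * ((L_x L \<theta> (x \<theta>) (u \<theta> + \<eta>) - L_x L \<theta> (x \<theta>) (u \<theta>)) \<bullet> \<eta>)
      + (1 - lam) * ((L_x L \<theta> (x \<theta>) (u \<theta> + \<xi>) - L_x L \<theta> (x \<theta>) (u \<theta>)) \<bullet> \<eta>)"
    "vector_derivative ((\<lambda>t. Q2 L I x t lam \<eta>)(\<theta> := Lim (at \<theta> within R) (\<lambda>t. Q2 L I x t lam \<eta>)))
      (at \<theta> within R) = lam\<^sup>2 * A + (1 - lam\<^sup>2) * A'"
proof -
  obtain A where A: "((\<lambda>t. excess L x u t 0 \<eta>) has_real_derivative A) (at \<theta> within R)"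
    using excess_0_has_derivative[OF \<theta> Lv x' u'] by blast
  obtain A' where A': "((\<lambda>t. excess L x u t 0 \<xi>) has_real_derivative A') (at \<theta> within R)"
    using excess_0_has_derivative[OF \<theta> Lv x' u'] by blast
  have E: "eventually (\<lambda>t. Ebar L I x t z = excess L x u t 0 z) (at \<theta> within R)" for z
    using ev by eventually_elim (rule Ebar_eq_excess)
  have Q: "eventually (\<lambda>t. Q2 L I x t lam \<eta>
      = lam\<^sup>2 * excess L x u t 0 \<eta> + (1 - lam\<^sup>2) * excess L x u t 0 \<xi>) (at \<theta> within R)"
    using E[of \<eta>] E[of \<xi>] by eventually_elim (simp add: Q2_def \<xi>)
  have Q': "((\<lambda>t. lam\<^sup>2 * excess L x u t 0 \<eta> + (1 - lam\<^sup>2) * excess L x u t 0 \<xi>)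
      has_real_derivative lam\<^sup>2 * A + (1 - lam\<^sup>2) * A') (at \<theta> within R)"
    by (intro DERIV_add DERIV_cmult A A')
  let ?M = "\<lambda>t. lam * ((L_x L t (x t) (u t + \<eta>) - L_x L t (x t) (u t)) \<bullet> \<eta>)
      + (1 - lam) * ((L_x L t (x t) (u t + \<xi>) - L_x L t (x t) (u t)) \<bullet> \<eta>)"
  have lims: "(x \<longlongrightarrow> x \<theta>) (at \<theta> within R)" "(u \<longlongrightarrow> u \<theta>) (at \<theta> within R)"
    using has_vector_derivative_continuous[OF x'] has_vector_derivative_continuous[OF u']
    by (simp_all add: continuous_within)
  have "(?M \<longlongrightarrow> ?M \<theta>) (at \<theta> within R)"
    by (intro tendsto_intros tendsto_L_x_comp lims \<theta>)
  moreover have "eventually (\<lambda>t. ?M t = M1 L I x t lam \<eta>) (at \<theta> within R)"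
    using ev by eventually_elim (simp add: M1_def DLx_def \<xi>)
  ultimately have "((\<lambda>t. M1 L I x t lam \<eta>) \<longlongrightarrow> ?M \<theta>) (at \<theta> within R)"
    by (rule Lim_transform_eventually)
  from tendsto_Lim[OF bot this] show thesis
    using that[OF A A'] one_sided_value_and_derivative[OF bot E A]
      one_sided_value_and_derivative[OF bot E A'] one_sided_value_and_derivative[OF bot Q Q']
    by blast
qed

text \<open>At an angular point the value of \<open>vel {t0..t1} x\<close> is arbitrary, whereas
  \<open>vel S x\<close> is the one-sided derivative there; the two agree in the interior of
  \<open>S\<close>.\<close>

lemma (in weak_minimum) twice_differentiable_on_vel:
  assumes "twice_differentiable_on S x" "S \<subseteq> {t0..t1}"
  shows "continuous_on S (vel S x)"
    and "t \<in> interior S \<Longrightarrow> (x has_vector_derivative vel S x t) (at t)"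
    and "t \<in> interior S \<Longrightarrow> vel {t0..t1} x t = vel S x t"
    and "t \<in> S \<Longrightarrow> (x has_vector_derivative vel S x t) (at t within S)"
    and "t \<in> S \<Longrightarrow> \<exists>u'. (vel S x has_vector_derivative u') (at t within S)"
proof -
  have d: "x differentiable (at t within S)" "vel S x differentiable (at t within S)" if "t \<in> S" for t
    using assms(1) that by (auto simp: twice_differentiable_on_def)
  show "continuous_on S (vel S x)"
    using d(2) differentiable_imp_continuous_within by (auto simp: continuous_on_eq_continuous_within)
  show D: "(x has_vector_derivative vel S x t) (at t within S)" if "t \<in> S" for t
    by (rule has_vector_derivative_vel[OF d(1)[OF that]])
  show "\<exists>u'. (vel S x has_vector_derivative u') (at t within S)" if "t \<in> S"
    using d(2)[OF that] vector_derivative_works by blast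
  show D': "(x has_vector_derivative vel S x t) (at t)" if "t \<in> interior S" for t
    using D[of t] that at_within_interior[OF that] interior_subset by fastforce
  show "vel {t0..t1} x t = vel S x t" if "t \<in> interior S"
    using interior_mono[OF assms(2)] that by (intro vel_eqI_interior D') auto
qed

context weak_minimum
begin

lemma right_condition:
  assumes Lv: "\<And>t x v. t \<in> T \<Longrightarrow> (\<lambda>(t, x, v). L_v L t x v) differentiable (at (t, x, v))"
    and S0: "0 < \<alpha>" "{\<theta>..<\<theta> + \<alpha>} \<subseteq> {t0..t1}" and tw: "twice_differentiable_on {\<theta>..<\<theta> + \<alpha>} x"
    and lam: "lam \<in> {0<..<1}" and \<xi>: "\<xi> = (lam / (lam - 1)) *\<^sub>R \<eta>" and norm: "norm \<eta> \<le> d" "norm \<xi> \<le> d"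
    and zero: "rval (\<lambda>t. Ebar L {t0..t1} x t \<eta>) \<theta> = 0" "rval (\<lambda>t. Ebar L {t0..t1} x t \<xi>) \<theta> = 0"
  shows "0 \<le> lam * rval (\<lambda>t. M1 L {t0..t1} x t lam \<eta>) \<theta> + rderiv (\<lambda>t. Q2 L {t0..t1} x t lam \<eta>) \<theta>"
proof -
  let ?S = "{\<theta>..<\<theta> + \<alpha>}"
  define u where "u = vel ?S x"
  note tw = twice_differentiable_on_vel[OF tw S0(2), folded u_def]
  \<comment> \<open>Halving passes from the half-open interval to a closed one, on which
    \<open>u\<close> is continuous up to both ends.\<close>
  define \<beta> where "\<beta> = \<alpha> / 2"
  have \<beta>: "0 < \<beta>" "{\<theta>..\<theta> + \<beta>} \<subseteq> ?S" "{\<theta><..<\<theta> + \<beta>} \<subseteq> interior ?S" "\<theta> \<in> ?S"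
    using S0(1) by (auto simp: \<beta>_def)
  have \<beta>I: "{\<theta>..\<theta> + \<beta>} \<subseteq> {t0..t1}" using \<beta>(2) S0(2) by (rule subset_trans)
  have \<theta>: "\<theta> \<in> T" using \<beta>(4) S0(2) I by blast
  have R: "at \<theta> within {\<theta>..\<theta> + \<beta>} = at_right \<theta>" using \<beta>(1) by (intro at_within_Icc_at_right) simp
  obtain u' where u': "(u has_vector_derivative u') (at \<theta> within {\<theta>..\<theta> + \<beta>})"
    using tw(5)[OF \<beta>(4)] has_vector_derivative_within_subset[OF _ \<beta>(2)] by blast
  have x': "(x has_vector_derivative u \<theta>) (at \<theta> within {\<theta>..\<theta> + \<beta>})"
    using tw(4)[OF \<beta>(4)] by (rule has_vector_derivative_within_subset) (fact \<beta>(2))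
  have "eventually (\<lambda>t. t \<in> {\<theta><..<\<theta> + \<beta>}) (at_right \<theta>)"
    using \<beta>(1) by (intro eventually_at_right_real) simp
  then have ev: "eventually (\<lambda>t. vel {t0..t1} x t = u t) (at_right \<theta>)"
    by eventually_elim (use \<beta>(3) tw(3) in blast)
  obtain A A' where A: "((\<lambda>t. excess L x u t 0 \<eta>) has_real_derivative A) (at_right \<theta>)"
    "((\<lambda>t. excess L x u t 0 \<xi>) has_real_derivative A') (at_right \<theta>)"
    and val: "rval (\<lambda>t. Ebar L {t0..t1} x t \<eta>) \<theta> = excess L x u \<theta> 0 \<eta>"
    "rval (\<lambda>t. Ebar L {t0..t1} x t \<xi>) \<theta> = excess L x u \<theta> 0 \<xi>"
    "rval (\<lambda>t. M1 L {t0..t1} x t lam \<eta>) \<theta> =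
      lam * ((L_x L \<theta> (x \<theta>) (u \<theta> + \<eta>) - L_x L \<theta> (x \<theta>) (u \<theta>)) \<bullet> \<eta>)
      + (1 - lam) * ((L_x L \<theta> (x \<theta>) (u \<theta> + \<xi>) - L_x L \<theta> (x \<theta>) (u \<theta>)) \<bullet> \<eta>)"
    "rderiv (\<lambda>t. Q2 L {t0..t1} x t lam \<eta>) \<theta> = lam\<^sup>2 * A + (1 - lam\<^sup>2) * A'"
    using one_sided_values[OF \<theta> trivial_limit_at_right_real Lv[OF \<theta>] ev x'[unfolded R] u'[unfolded R] \<xi>]
    unfolding rval_def rderiv_def by blast
  show ?thesis
    unfolding val(3,4)
  proof (rule second_order_condition_right[OF \<beta>(1) \<beta>I _ _ x' u' lam \<xi> norm])
    show "continuous_on {\<theta>..\<theta> + \<beta>} u" by (rule continuous_on_subset[OF tw(1) \<beta>(2)])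
    show "(x has_vector_derivative u t) (at t)" if "t \<in> {\<theta><..<\<theta> + \<beta>}" for t
      using that \<beta>(3) by (intro tw(2)) blast
  qed (use A zero val in \<open>simp_all add: R\<close>)
qed

lemma left_condition:
  assumes Lv: "\<And>t x v. t \<in> T \<Longrightarrow> (\<lambda>(t, x, v). L_v L t x v) differentiable (at (t, x, v))"
    and S0: "0 < \<alpha>" "{\<theta> - \<alpha><..\<theta>} \<subseteq> {t0..t1}" and tw: "twice_differentiable_on {\<theta> - \<alpha><..\<theta>} x"
    and lam: "lam \<in> {0<..<1}" and \<xi>: "\<xi> = (lam / (lam - 1)) *\<^sub>R \<eta>" and norm: "norm \<eta> \<le> d" "norm \<xi> \<le> d"
    and zero: "lval (\<lambda>t. Ebar L {t0..t1} x t \<eta>) \<theta> = 0" "lval (\<lambda>t. Ebar L {t0..t1} x t \<xi>) \<theta> = 0"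
  shows "lam * lval (\<lambda>t. M1 L {t0..t1} x t lam \<eta>) \<theta> + lderiv (\<lambda>t. Q2 L {t0..t1} x t lam \<eta>) \<theta> \<le> 0"
proof -
  let ?S = "{\<theta> - \<alpha><..\<theta>}"
  define u where "u = vel ?S x"
  note tw = twice_differentiable_on_vel[OF tw S0(2), folded u_def]
  define \<beta> where "\<beta> = \<alpha> / 2"
  have \<beta>: "0 < \<beta>" "{\<theta> - \<beta>..\<theta>} \<subseteq> ?S" "{\<theta> - \<beta><..<\<theta>} \<subseteq> interior ?S" "\<theta> \<in> ?S"
    using S0(1) by (auto simp: \<beta>_def)
  have \<beta>I: "{\<theta> - \<beta>..\<theta>} \<subseteq> {t0..t1}" using \<beta>(2) S0(2) by (rule subset_trans)
  have \<theta>: "\<theta> \<in> T" using \<beta>(4) S0(2) I by blast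
  have R: "at \<theta> within {\<theta> - \<beta>..\<theta>} = at_left \<theta>" using \<beta>(1) by (intro at_within_Icc_at_left) simp
  obtain u' where u': "(u has_vector_derivative u') (at \<theta> within {\<theta> - \<beta>..\<theta>})"
    using tw(5)[OF \<beta>(4)] has_vector_derivative_within_subset[OF _ \<beta>(2)] by blast
  have x': "(x has_vector_derivative u \<theta>) (at \<theta> within {\<theta> - \<beta>..\<theta>})"
    using tw(4)[OF \<beta>(4)] by (rule has_vector_derivative_within_subset) (fact \<beta>(2))
  have "eventually (\<lambda>t. t \<in> {\<theta> - \<beta><..<\<theta>}) (at_left \<theta>)"
    using \<beta>(1) by (intro eventually_at_left_real) simp
  then have ev: "eventually (\<lambda>t. vel {t0..t1} x t = u t) (at_left \<theta>)"
    by eventually_elim (use \<beta>(3) tw(3) in blast)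
  obtain A A' where A: "((\<lambda>t. excess L x u t 0 \<eta>) has_real_derivative A) (at_left \<theta>)"
    "((\<lambda>t. excess L x u t 0 \<xi>) has_real_derivative A') (at_left \<theta>)"
    and val: "lval (\<lambda>t. Ebar L {t0..t1} x t \<eta>) \<theta> = excess L x u \<theta> 0 \<eta>"
    "lval (\<lambda>t. Ebar L {t0..t1} x t \<xi>) \<theta> = excess L x u \<theta> 0 \<xi>"
    "lval (\<lambda>t. M1 L {t0..t1} x t lam \<eta>) \<theta> =
      lam * ((L_x L \<theta> (x \<theta>) (u \<theta> + \<eta>) - L_x L \<theta> (x \<theta>) (u \<theta>)) \<bullet> \<eta>)
      + (1 - lam) * ((L_x L \<theta> (x \<theta>) (u \<theta> + \<xi>) - L_x L \<theta> (x \<theta>) (u \<theta>)) \<bullet> \<eta>)"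
    "lderiv (\<lambda>t. Q2 L {t0..t1} x t lam \<eta>) \<theta> = lam\<^sup>2 * A + (1 - lam\<^sup>2) * A'"
    using one_sided_values[OF \<theta> trivial_limit_at_left_real Lv[OF \<theta>] ev x'[unfolded R] u'[unfolded R] \<xi>]
    unfolding lval_def lderiv_def by blast
  show ?thesis
    unfolding val(3,4)
  proof (rule second_order_condition_left[OF \<beta>(1) \<beta>I _ _ x' u' lam \<xi> norm])
    show "continuous_on {\<theta> - \<beta>..\<theta>} u" by (rule continuous_on_subset[OF tw(1) \<beta>(2)])
    show "(x has_vector_derivative u t) (at t)" if "t \<in> {\<theta> - \<beta><..<\<theta>}" for t
      using that \<beta>(3) by (intro tw(2)) blast
  qed (use A zero val in \<open>simp_all add: R\<close>)
qed

lemma two_sided_condition: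
  assumes Lv: "\<And>t x v. t \<in> T \<Longrightarrow> (\<lambda>(t, x, v). L_v L t x v) differentiable (at (t, x, v))"
    and \<theta>: "\<theta> \<in> {t0<..<t1}" and tw: "twice_differentiable_at \<theta> x"
    and lam: "lam \<in> {0<..<1}" and \<xi>: "\<xi> = (lam / (lam - 1)) *\<^sub>R \<eta>" and norm: "norm \<eta> \<le> d" "norm \<xi> \<le> d"
    and zero: "Ebar L {t0..t1} x \<theta> \<eta> = 0" "Ebar L {t0..t1} x \<theta> \<xi> = 0"
  shows "lam * (DLx L {t0..t1} x \<theta> \<eta> \<bullet> \<eta>) + (1 - lam) * (DLx L {t0..t1} x \<theta> \<xi> \<bullet> \<eta>) = 0"
proof -
  define u where "u t = vector_derivative x (at t)" for t
  have \<theta>T: "\<theta> \<in> T" using \<theta> I by auto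
  obtain N where N: "finite N" "continuous_on ({t0..t1} - N) (vel {t0..t1} x)"
    using KC1E[OF x_in_KC1] by metis
  have "eventually (\<lambda>t. t \<notin> N) (at \<theta>)"
    by (rule eventually_at_within_notin_finite[OF N(1)])
  then have "eventually (\<lambda>t. t \<noteq> \<theta> \<longrightarrow> t \<notin> N) (nhds \<theta>)" by (simp add: eventually_at_filter)
  moreover have "eventually (\<lambda>t. t \<in> {t0<..<t1}) (nhds \<theta>)"
    using \<theta> by (intro eventually_nhds_in_open) auto
  moreover have "eventually (\<lambda>t. x differentiable (at t)) (nhds \<theta>)"
    using tw by (simp add: twice_differentiable_at_def)
  ultimately have "eventually (\<lambda>t. (t \<noteq> \<theta> \<longrightarrow> t \<notin> N) \<and> t \<in> {t0<..<t1} \<and> x differentiable (at t)) (nhds \<theta>)"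
    by eventually_elim simp
  then obtain \<rho> where \<rho>: "0 < \<rho>" "\<And>t. \<bar>t - \<theta>\<bar> < \<rho> \<Longrightarrow>
      (t \<noteq> \<theta> \<longrightarrow> t \<notin> N) \<and> t \<in> {t0<..<t1} \<and> x differentiable (at t)"
    unfolding eventually_nhds_metric dist_real_def by blast
  define \<beta> where "\<beta> = \<rho> / 2"
  have \<beta>: "0 < \<beta>" using \<rho>(1) by (simp add: \<beta>_def)
  have near: "\<bar>t - \<theta>\<bar> < \<rho>" if "t \<in> {\<theta> - \<beta>..\<theta> + \<beta>}" for t
    using that \<beta> by (auto simp: \<beta>_def)
  have D: "(x has_vector_derivative u t) (at t)" if "\<bar>t - \<theta>\<bar> < \<rho>" for t
    using \<rho>(2)[OF that] unfolding u_def by (simp add: vector_derivative_works)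
  have v: "vel {t0..t1} x t = u t" if "\<bar>t - \<theta>\<bar> < \<rho>" for t
    using \<rho>(2)[OF that] by (intro vel_eqI_interior D that) auto
  obtain u' where u': "(u has_vector_derivative u') (at \<theta>)"
    using tw unfolding twice_differentiable_at_def u_def using vector_derivative_works by blast
  \<comment> \<open>Twice differentiability at \<theta> yields continuity of \<open>u\<close> at
    \<theta> alone; at nearby points it comes from \<open>KC1\<close>, whose other exceptional
    points were excluded by the choice of \<rho>.\<close>
  have "isCont u t" if t: "\<bar>t - \<theta>\<bar> < \<rho>" for t
  proof (cases "t = \<theta>")
    case True
    then show ?thesis using has_vector_derivative_continuous[OF u'] by simp
  next
    case False
    then have "isCont (vel {t0..t1} x) t"
      using \<rho>(2)[OF t] by (intro isCont_off_finite[OF N]) auto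
    moreover have "eventually (\<lambda>s. s \<in> ball \<theta> \<rho>) (nhds t)"
      using t by (intro eventually_nhds_in_open) (auto simp: dist_real_def)
    then have "eventually (\<lambda>s. vel {t0..t1} x s = u s) (nhds t)"
      by eventually_elim (auto simp: dist_real_def intro!: v)
    ultimately show ?thesis by (simp add: isCont_cong)
  qed
  then have u: "continuous_on S u" if "S \<subseteq> {\<theta> - \<beta>..\<theta> + \<beta>}" for S
    using that near by (intro continuous_at_imp_continuous_on) blast
  have sub: "{\<theta> - \<beta>..\<theta> + \<beta>} \<subseteq> {t0..t1}" using near \<rho>(2) by fastforce
  have E: "excess L x u \<theta> 0 \<eta> = 0" "excess L x u \<theta> 0 \<xi> = 0"
    using zero Ebar_eq_excess[of "{t0..t1}" x \<theta> u] v[of \<theta>] \<rho>(1) by auto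
  have x': "(x has_vector_derivative u \<theta>) (at \<theta>)" using D[of \<theta>] \<rho>(1) by simp
  have stationary: "((\<lambda>t. excess L x u t 0 z) has_real_derivative 0) (at \<theta>)"
    if z: "norm z \<le> d" "excess L x u \<theta> 0 z = 0" for z
  proof -
    obtain A where A: "((\<lambda>t. excess L x u t 0 z) has_real_derivative A) (at \<theta>)"
      using excess_0_has_derivative[OF \<theta>T Lv[OF \<theta>T] x' u'] by blast
    \<comment> \<open>The Weierstrass condition at each \<open>t\<close> near \<theta>, with hats
      placed in \<open>{t..\<theta> + \<beta>}\<close>. It holds on both sides of \<theta>, so the
      excess has a local minimum, with value 0, at \<theta>.\<close>
    have "0 \<le> excess L x u t 0 z" if t: "\<bar>\<theta> - t\<bar> < \<beta>" for t
    proof (rule weierstrass_condition[OF _ _ u _ z(1)])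
      show "0 < \<theta> + \<beta> - t" using t by auto
      show "{t..t + (\<theta> + \<beta> - t)} \<subseteq> {\<theta> - \<beta>..\<theta> + \<beta>}" using t by auto
      then show "{t..t + (\<theta> + \<beta> - t)} \<subseteq> {t0..t1}" using sub by (rule subset_trans)
      show "(x has_vector_derivative u s) (at s)" if "s \<in> {t<..<t + (\<theta> + \<beta> - t)}" for s
        using that t by (intro D near) auto
    qed
    then have "A = 0"
      using z(2) by (intro DERIV_local_min[OF A \<beta>]) auto
    with A show ?thesis by simp
  qed
  note A = stationary[OF norm(1) E(1)] and A' = stationary[OF norm(2) E(2)]
  let ?M = "lam * ((L_x L \<theta> (x \<theta>) (u \<theta> + \<eta>) - L_x L \<theta> (x \<theta>) (u \<theta>)) \<bullet> \<eta>)
      + (1 - lam) * ((L_x L \<theta> (x \<theta>) (u \<theta> + \<xi>) - L_x L \<theta> (x \<theta>) (u \<theta>)) \<bullet> \<eta>)"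
  have "0 \<le> lam * ?M + (lam\<^sup>2 * 0 + (1 - lam\<^sup>2) * 0)"
  proof (rule second_order_condition_right[OF \<beta> _ u _ _ _ lam \<xi> norm _ E(1) _ E(2)])
    show "{\<theta>..\<theta> + \<beta>} \<subseteq> {t0..t1}" "{\<theta>..\<theta> + \<beta>} \<subseteq> {\<theta> - \<beta>..\<theta> + \<beta>}" using sub \<beta> by auto
    show "(x has_vector_derivative u t) (at t)" if "t \<in> {\<theta><..<\<theta> + \<beta>}" for t
      using that \<beta> by (intro D near) auto
  qed (fact x'[THEN has_vector_derivative_at_within] u'[THEN has_vector_derivative_at_within]
      A[THEN has_field_derivative_at_within] A'[THEN has_field_derivative_at_within])+
  moreover have "lam * ?M + (lam\<^sup>2 * 0 + (1 - lam\<^sup>2) * 0) \<le> 0"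
  proof (rule second_order_condition_left[OF \<beta> _ u _ _ _ lam \<xi> norm _ E(1) _ E(2)])
    show "{\<theta> - \<beta>..\<theta>} \<subseteq> {t0..t1}" "{\<theta> - \<beta>..\<theta>} \<subseteq> {\<theta> - \<beta>..\<theta> + \<beta>}" using sub \<beta> by auto
    show "(x has_vector_derivative u t) (at t)" if "t \<in> {\<theta> - \<beta><..<\<theta>}" for t
      using that \<beta> by (intro D near) auto
  qed (fact x'[THEN has_vector_derivative_at_within] u'[THEN has_vector_derivative_at_within]
      A[THEN has_field_derivative_at_within] A'[THEN has_field_derivative_at_within])+
  ultimately have "?M = 0" using lam by (simp add: mult_le_0_iff zero_le_mult_iff)
  then show ?thesis
    using v[of \<theta>] \<rho>(1) by (simp add: DLx_def)
qed

end

theorem theorem3p4: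
  fixes a b :: ereal and t0 t1 :: real
    and L :: "real \<Rightarrow> real ^ 'n::finite \<Rightarrow> real ^ 'n \<Rightarrow> real"
    and x0 x1 :: "real ^ 'n" and xb :: "real \<Rightarrow> real ^ 'n"
  assumes "t0 < t1" and "{t0..t1} \<subseteq> einterval a b"
    and "C1_on (einterval a b \<times> UNIV \<times> UNIV) (\<lambda>(t, x, v). L t x v)"
    and "C1_on (einterval a b \<times> UNIV \<times> UNIV) (\<lambda>(t, x, v). L_v L t x v)"
    and "weak_local_min L t0 t1 x0 x1 xb"
  shows "\<exists>\<delta>>0.
    (\<forall>\<theta>\<in>{t0..<t1}. \<forall>\<alpha>>0. {\<theta>..<\<theta> + \<alpha>} \<subseteq> {t0..t1} \<and> twice_differentiable_on {\<theta>..<\<theta> + \<alpha>} xb \<longrightarrow>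
      (\<forall>\<eta> lam. \<eta> \<in> cball 0 \<delta> \<and> (lam / (lam - 1)) *\<^sub>R \<eta> \<in> cball 0 \<delta> \<and> lam \<in> {0<..<1} \<and>
        rval (\<lambda>t. Ebar L {t0..t1} xb t \<eta>) \<theta> = 0 \<and>
        rval (\<lambda>t. Ebar L {t0..t1} xb t ((lam / (lam - 1)) *\<^sub>R \<eta>)) \<theta> = 0 \<longrightarrow>
        lam * rval (\<lambda>t. M1 L {t0..t1} xb t lam \<eta>) \<theta> + rderiv (\<lambda>t. Q2 L {t0..t1} xb t lam \<eta>) \<theta> \<ge> 0)) \<and>
    (\<forall>\<theta>\<in>{t0<..t1}. \<forall>\<alpha>>0. {\<theta> - \<alpha><..\<theta>} \<subseteq> {t0..t1} \<and> twice_differentiable_on {\<theta> - \<alpha><..\<theta>} xb \<longrightarrow>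
      (\<forall>\<eta> lam. \<eta> \<in> cball 0 \<delta> \<and> (lam / (lam - 1)) *\<^sub>R \<eta> \<in> cball 0 \<delta> \<and> lam \<in> {0<..<1} \<and>
        lval (\<lambda>t. Ebar L {t0..t1} xb t \<eta>) \<theta> = 0 \<and>
        lval (\<lambda>t. Ebar L {t0..t1} xb t ((lam / (lam - 1)) *\<^sub>R \<eta>)) \<theta> = 0 \<longrightarrow>
        lam * lval (\<lambda>t. M1 L {t0..t1} xb t lam \<eta>) \<theta> + lderiv (\<lambda>t. Q2 L {t0..t1} xb t lam \<eta>) \<theta> \<le> 0)) \<and>
    (\<forall>\<theta>\<in>{t0<..<t1}. twice_differentiable_at \<theta> xb \<longrightarrow>
      (\<forall>\<eta> lam. \<eta> \<in> cball 0 \<delta> \<and> (lam / (lam - 1)) *\<^sub>R \<eta> \<in> cball 0 \<delta> \<and> lam \<in> {0<..<1} \<and>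
        Ebar L {t0..t1} xb \<theta> \<eta> = 0 \<and> Ebar L {t0..t1} xb \<theta> ((lam / (lam - 1)) *\<^sub>R \<eta>) = 0 \<longrightarrow>
        lam * (DLx L {t0..t1} xb \<theta> \<eta> \<bullet> \<eta>)
          + (1 - lam) * (DLx L {t0..t1} xb \<theta> ((lam / (lam - 1)) *\<^sub>R \<eta>) \<bullet> \<eta>) = 0))"
proof -
  let ?T = "einterval a b"
  obtain dL where dL: "\<forall>z\<in>?T \<times> UNIV \<times> UNIV. ((\<lambda>(t, x, v). L t x v) has_derivative blinfun_apply (dL z)) (at z)"
    "continuous_on (?T \<times> UNIV \<times> UNIV) dL"
    using assms(3) unfolding C1_on_def by blast
  have Lv: "(\<lambda>(t, x, v). L_v L t x v) differentiable (at (t, x, v))" if "t \<in> ?T" for t x v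
    using assms(4) that unfolding C1_on_def differentiable_def by blast
  \<comment> \<open>The radius of weak minimality itself serves as \<delta>: hats with slopes in
    that ball and support of length at most 1 yield competitors.\<close>
  obtain \<delta> where \<delta>: "0 < \<delta>" and min: "\<And>x. admissible t0 t1 x0 x1 x \<Longrightarrow>
      max (C_norm {t0..t1} (\<lambda>t. x t - xb t))
          (Linf_norm {t0..t1} (\<lambda>t. vel {t0..t1} x t - vel {t0..t1} xb t)) \<le> ereal \<delta> \<Longrightarrow>
      J L t0 t1 xb \<le> J L t0 t1 x"
    and adm: "admissible t0 t1 x0 x1 xb"
    using assms(5) unfolding weak_local_min_def by blast
  interpret weak_minimum ?T L dL t0 t1 \<delta> x0 x1 xb
  proof
    show "((\<lambda>(t, x, v). L t x v) has_derivative blinfun_apply (dL (t, x, v))) (at (t, x, v))"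
      if "t \<in> ?T" for t x v
      using dL(1) that by blast
  qed (fact open_einterval dL(2) assms(2) adm min)+
  show ?thesis
  proof (intro exI[of _ \<delta>] conjI ballI allI impI \<delta>; (elim conjE)?)
    fix \<theta> \<alpha> lam :: real and \<eta> :: "real ^ 'n"
    assume "0 < \<alpha>" "{\<theta>..<\<theta> + \<alpha>} \<subseteq> {t0..t1}" "twice_differentiable_on {\<theta>..<\<theta> + \<alpha>} xb"
      "\<eta> \<in> cball 0 \<delta>" "(lam / (lam - 1)) *\<^sub>R \<eta> \<in> cball 0 \<delta>" "lam \<in> {0<..<1}"
      "rval (\<lambda>t. Ebar L {t0..t1} xb t \<eta>) \<theta> = 0"
      "rval (\<lambda>t. Ebar L {t0..t1} xb t ((lam / (lam - 1)) *\<^sub>R \<eta>)) \<theta> = 0"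
    then show "0 \<le> lam * rval (\<lambda>t. M1 L {t0..t1} xb t lam \<eta>) \<theta> + rderiv (\<lambda>t. Q2 L {t0..t1} xb t lam \<eta>) \<theta>"
      by (intro right_condition[OF Lv _ _ _ _ refl]) (simp_all only: mem_cball_0)
  next
    fix \<theta> \<alpha> lam :: real and \<eta> :: "real ^ 'n"
    assume "0 < \<alpha>" "{\<theta> - \<alpha><..\<theta>} \<subseteq> {t0..t1}" "twice_differentiable_on {\<theta> - \<alpha><..\<theta>} xb"
      "\<eta> \<in> cball 0 \<delta>" "(lam / (lam - 1)) *\<^sub>R \<eta> \<in> cball 0 \<delta>" "lam \<in> {0<..<1}"
      "lval (\<lambda>t. Ebar L {t0..t1} xb t \<eta>) \<theta> = 0"
      "lval (\<lambda>t. Ebar L {t0..t1} xb t ((lam / (lam - 1)) *\<^sub>R \<eta>)) \<theta> = 0"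
    then show "lam * lval (\<lambda>t. M1 L {t0..t1} xb t lam \<eta>) \<theta> + lderiv (\<lambda>t. Q2 L {t0..t1} xb t lam \<eta>) \<theta> \<le> 0"
      by (intro left_condition[OF Lv _ _ _ _ refl]) (simp_all only: mem_cball_0)
  next
    fix \<theta> lam :: real and \<eta> :: "real ^ 'n"
    assume "\<theta> \<in> {t0<..<t1}" "twice_differentiable_at \<theta> xb"
      "\<eta> \<in> cball 0 \<delta>" "(lam / (lam - 1)) *\<^sub>R \<eta> \<in> cball 0 \<delta>" "lam \<in> {0<..<1}"
      "Ebar L {t0..t1} xb \<theta> \<eta> = 0" "Ebar L {t0..t1} xb \<theta> ((lam / (lam - 1)) *\<^sub>R \<eta>) = 0"
    then show "lam * (DLx L {t0..t1} xb \<theta> \<eta> \<bullet> \<eta>)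
        + (1 - lam) * (DLx L {t0..t1} xb \<theta> ((lam / (lam - 1)) *\<^sub>R \<eta>) \<bullet> \<eta>) = 0"
      by (intro two_sided_condition[OF Lv _ _ _ refl]) (simp_all only: mem_cball_0)
  qed
qed

end
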